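(* For each $n$ let $m=m(n)$ be any integer with $1\le m\le n/2$, let $G=K_{m,n-m}$ be the complete bipartite graph with parts of sizes $m$ and $n-m$, with vertex set $V$, $|V|=n$, and let $(\eta_t)_{t\ge0}$ be the averaging process on $G$. Let $\pi\equiv1/n$ be the uniform distribution on $V$ and let $$T(a):=\frac{n}{2(n-m)}\,\frac{\log_2 n}{m}+a\,\frac{\sqrt{\log n}}{m},\qquad a\in\mathbb{R}.$$ Then $$\lim_{a\to\infty}\limsup_{n\to\infty}\sup_{\xi\in\Delta(V)}\mathbb{E}_\xi\left[\left\|\frac{\eta_{T(a)}}{\pi}-1\right\|_1\right]=0$$ and $$\lim_{a\to-\infty}\liminf_{n\to\infty}\sup_{\xi\in\Delta(V)}\mathbb{E}_\xi\left[\left\|\frac{\eta_{T(a)}}{\pi}-1\right\|_1\right]=2.$$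
   Context: For a finite connected graph $G=(V,E)$, let $\Delta(V)$ be the set of probability mass functions on $V$. The averaging process on $G$ is the continuous-time Markov process $(\eta_t)_{t\ge0}$ on $\Delta(V)$ in which each edge $xy\in E$ carries an independent Poisson clock of rate $1$; when the clock of $xy$ rings, both $\eta(x)$ and $\eta(y)$ are replaced by $\frac12(\eta(x)+\eta(y))$, the other values being unchanged. $\mathbb{E}_\xi$ is the expectation when $\eta_0=\xi\in\Delta(V)$. For $f:V\to\mathbb{R}$, $\|f\|_1=\sum_{x\in V}\pi(x)|f(x)|$ is the $L^1(\pi)$-norm, and $\eta/\pi$ denotes the function $x\mapsto\eta(x)/\pi(x)=n\,\eta(x)$. For fixed $a$, $T(a)\geq0$ for all $n$ large enough. $\log$ is the natural logarithm and $\log_2$ the logarithm in base $2$. *)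

theory Defs
  imports "HOL-Probability.Probability"
begin

definition prob_mass_functions :: "'v set \<Rightarrow> ('v \<Rightarrow> real) set" where
  "prob_mass_functions V = {\<xi>. (\<forall>x. 0 \<le> \<xi> x) \<and> (\<forall>x. x \<notin> V \<longrightarrow> \<xi> x = 0) \<and> (\<Sum>x\<in>V. \<xi> x) = 1}"

(* Unit-rate Poisson process on [0,oo), as a counting process; its values at negative times are
   irrelevant.  Paths are almost surely nondecreasing, so the natural-number subtraction in the
   increments truncates only on a null set. *)
definition poisson_clock :: "'a measure \<Rightarrow> (real \<Rightarrow> 'a \<Rightarrow> nat) \<Rightarrow> bool" where
  "poisson_clock M N \<longleftrightarrow>
     (\<forall>t\<ge>0. N t \<in> measurable M (count_space UNIV)) \<and>
     (AE \<omega> in M. N 0 \<omega> = 0 \<and> mono_on {0..} (\<lambda>t. N t \<omega>) \<and>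
        (\<forall>t\<ge>0. continuous (at_right t) (\<lambda>s. N s \<omega>))) \<and>
     (\<forall>s t. 0 \<le> s \<longrightarrow> s < t \<longrightarrow>
        distr M (count_space UNIV) (\<lambda>\<omega>. N t \<omega> - N s \<omega>) = measure_pmf (poisson_pmf (t - s))) \<and>
     (\<forall>(\<tau> :: nat \<Rightarrow> real) k. 0 \<le> \<tau> 0 \<longrightarrow> mono \<tau> \<longrightarrow>
        prob_space.indep_vars M (\<lambda>_. count_space UNIV)
          (\<lambda>i \<omega>. N (\<tau> (Suc i)) \<omega> - N (\<tau> i) \<omega>) {..<k})"

(* Independence between different clocks is independence of whole sample paths, viewed as random
   elements of the product space of functions from [0,oo) to nat. *)
definition poisson_clocks :: "'a measure \<Rightarrow> 'e set \<Rightarrow> ('e \<Rightarrow> real \<Rightarrow> 'a \<Rightarrow> nat) \<Rightarrow> bool" where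
  "poisson_clocks M E N \<longleftrightarrow>
     (\<forall>e\<in>E. poisson_clock M (N e)) \<and>
     prob_space.indep_vars M (\<lambda>_. PiM {0..} (\<lambda>_. count_space UNIV))
       (\<lambda>e \<omega>. \<lambda>t\<in>{0..}. N e t \<omega>) E"

definition rings_at :: "(real \<Rightarrow> nat) \<Rightarrow> real \<Rightarrow> bool" where
  "rings_at c t \<longleftrightarrow> 0 < t \<and> (\<forall>s\<in>{0..<t}. c s < c t)"

definition average_edge :: "'v \<Rightarrow> 'v \<Rightarrow> ('v \<Rightarrow> real) \<Rightarrow> 'v \<Rightarrow> real" where
  "average_edge x y \<eta> = \<eta>(x := (\<eta> x + \<eta> y) / 2, y := (\<eta> x + \<eta> y) / 2)"

(* The averaging process on (V, E) started from \<xi>, realised on the probability space M.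
   In the jump rule, \<eta> r for r just below t is the value immediately before the ring at time t.
   Almost surely no two clocks ring simultaneously and only finitely many rings occur in any
   bounded time interval, so the last clause determines the path on [0,oo). *)
definition averaging_process ::
    "'v set \<Rightarrow> 'v set set \<Rightarrow> ('v \<Rightarrow> real) \<Rightarrow> 'a measure \<Rightarrow> (real \<Rightarrow> 'a \<Rightarrow> 'v \<Rightarrow> real) \<Rightarrow> bool" where
  "averaging_process V E \<xi> M \<eta> \<longleftrightarrow>
     prob_space M \<and>
     (\<forall>t\<ge>0. \<forall>\<omega>\<in>space M. \<eta> t \<omega> \<in> prob_mass_functions V) \<and>
     (\<forall>t\<ge>0. \<forall>x\<in>V. (\<lambda>\<omega>. \<eta> t \<omega> x) \<in> borel_measurable M) \<and>
     (\<exists>N. poisson_clocks M E N \<and>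
       (AE \<omega> in M. \<eta> 0 \<omega> = \<xi> \<and>
          (\<forall>s t. 0 \<le> s \<longrightarrow> s < t \<longrightarrow>
             (\<forall>e\<in>E. \<forall>u\<in>{s<..t}. \<not> rings_at (\<lambda>r. N e r \<omega>) u) \<longrightarrow> \<eta> t \<omega> = \<eta> s \<omega>) \<and>
          (\<forall>t x y. {x, y} \<in> E \<longrightarrow> rings_at (\<lambda>r. N {x, y} r \<omega>) t \<longrightarrow>
             (\<forall>\<^sub>F r in at_left t. \<eta> t \<omega> = average_edge x y (\<eta> r \<omega>)))))"

(* K_{m,k} with parts {0..<m} and {m..<m+k}. *)
definition complete_bipartite_edges :: "nat \<Rightarrow> nat \<Rightarrow> nat set set" where
  "complete_bipartite_edges m k = {{x, y} |x y. x \<in> {0..<m} \<and> y \<in> {m..<m + k}}"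

definition uniform_mass :: "'v set \<Rightarrow> 'v \<Rightarrow> real" where
  "uniform_mass V x = 1 / real (card V)"

definition L1_norm :: "'v set \<Rightarrow> ('v \<Rightarrow> real) \<Rightarrow> ('v \<Rightarrow> real) \<Rightarrow> real" where
  "L1_norm V \<pi> f = (\<Sum>x\<in>V. \<pi> x * \<bar>f x\<bar>)"

definition cutoff_time :: "nat \<Rightarrow> nat \<Rightarrow> real \<Rightarrow> real" where
  "cutoff_time n m a =
     real n / (2 * (real n - real m)) * (log 2 (real n) / real m) + a * (sqrt (ln (real n)) / real m)"

end

theory Submission
  imports Defs "HOL-Real_Asymp.Real_Asymp"
begin

text \<open>Let \<open>L = ln n\<close> and \<open>\<theta> = 1 / sqrt L\<close>. A piece of mass halves whenever its vertex rings, which happens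
  at rate \<open>2 m (n - m) / n\<close> in equilibrium, so until pieces merge their number of halvings follows the
  clock that defines the cutoff time, with fluctuations of order \<open>sqrt L\<close>. This is captured by the
  potentials \<open>\<Sum>x. w x * \<eta> x powr (1 \<plusminus> \<theta>)\<close>, whose weights \<open>w\<close> depend only on the part containing
  \<open>x\<close>.

  For the lower bound, the exponent \<open>1 - \<theta>\<close> is subadditive, so merging only helps, and
  \<open>2 - \<parallel>\<eta>/\<pi> - 1\<parallel>\<^sub>1 = 2 (\<Sum>x. min (\<eta> x) (1/n)) \<le> 2 n powr (- \<theta>) * (\<Sum>x. \<eta> x powr (1 - \<theta>))\<close>.
  For the upper bound, the exponent \<open>1 + \<theta>\<close> shows that at time \<open>T(0)\<close> the mass sitting on vertices
  with \<open>\<eta> x > exp (a sqrt L / 4) / n\<close> is at most \<open>C exp (- a / 4)\<close> in expectation; the remaining mass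
  has a small \<open>L\<^sup>2\<close> norm, and the spectral gap \<open>m / 2\<close> flattens it during the remaining time
  \<open>a sqrt L / m\<close>.\<close>

section \<open>Paths of the averaging process\<close>

text \<open>The value of \<open>\<theta>\<close> balances two effects. Both potentials drift at
  first-order rate \<open>2 ln 2 \<theta> m (n - m) / n\<close>; over the leading term of the cutoff
  time this integrates to exactly \<open>\<theta> L\<close>, the logarithmic gap between the
  potential of a point mass and that of the uniform distribution. A time shift
  \<open>a sqrt L / m\<close> changes the exponent by order \<open>a\<close>, while second-order
  errors, at rate \<open>O(m \<theta>\<^sup>2)\<close> over a time \<open>O(L / m)\<close>, cost
  \<open>O(1)\<close> because \<open>\<theta>\<^sup>2 L = 1\<close>. The obstacle is that
  \<open>m\<close> may be 1 while \<open>n\<close> is huge: vertices of the small part ring at rate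
  \<open>n - m\<close>, those of the large part at rate \<open>m\<close>, and an error at rate
  \<open>n \<theta>\<^sup>2\<close> would be ruinous. The weights, and for the upper bound a linear
  penalty on the small part, keep every error proportional to \<open>m\<close>.
  \<open>averaging_process\<close> supplies clocks and a jump rule, but neither a generator nor a
  Markov property. Discretised operators replace both, and only give upper bounds; so the lower
  bound is proved as an upper bound for 2 minus the distance.\<close>

definition edge_average :: "'v set \<Rightarrow> ('v \<Rightarrow> real) \<Rightarrow> 'v \<Rightarrow> real" where
  "edge_average e \<eta> = (\<lambda>z. if z \<in> e then (\<Sum>w\<in>e. \<eta> w) / 2 else \<eta> z)"

text \<open>The jump rule takes an ordered pair, whereas edges are sets. Half the sum over
  \<open>e\<close> is the mean because \<open>x \<noteq> y\<close> makes \<open>e\<close> a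
  doubleton.\<close>

lemma average_edge_eq: "x \<noteq> y \<Longrightarrow> average_edge x y \<eta> = edge_average {x, y} \<eta>"
  by (auto simp: average_edge_def edge_average_def fun_eq_iff)

text \<open>One letter of a ring history: \<open>None\<close> is an interval without rings,
  \<open>Some e\<close> an interval whose only ring is a single ring of \<open>e\<close>. Longer
  histories become words \<open>z\<close>.\<close>

fun ring_step :: "'v set option \<Rightarrow> ('v \<Rightarrow> real) \<Rightarrow> 'v \<Rightarrow> real" where
  "ring_step None \<eta> = \<eta>"
| "ring_step (Some e) \<eta> = edge_average e \<eta>"

fun ring_steps :: "(nat \<Rightarrow> 'v set option) \<Rightarrow> nat \<Rightarrow> ('v \<Rightarrow> real) \<Rightarrow> 'v \<Rightarrow> real" where
  "ring_steps z 0 \<eta> = \<eta>"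
| "ring_steps z (Suc k) \<eta> = ring_step (z k) (ring_steps z k \<eta>)"

definition edges_on :: "'v set \<Rightarrow> 'v set set" where
  "edges_on V = {{x, y} |x y. x \<in> V \<and> y \<in> V \<and> x \<noteq> y}"

lemma edge_average_pmf:
  assumes "finite V" "e \<in> edges_on V" "\<eta> \<in> prob_mass_functions V"
  shows "edge_average e \<eta> \<in> prob_mass_functions V"
proof -
  obtain x y where e: "e = {x, y}" "x \<in> V" "y \<in> V" "x \<noteq> y"
    using assms(2) by (auto simp: edges_on_def)
  have *: "(\<Sum>z\<in>V. g z) = g x + g y + (\<Sum>z\<in>V - {x, y}. g z)" for g :: "'a \<Rightarrow> real"
    using e assms(1) sum.subset_diff[of "{x, y}" V g] by simp
  have "(\<Sum>z\<in>V. edge_average e \<eta> z) = (\<Sum>z\<in>V. \<eta> z)"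
    unfolding *[of "edge_average e \<eta>"] *[of \<eta>] using e by (simp add: edge_average_def)
  then show ?thesis
    using assms(3) e by (auto simp: prob_mass_functions_def edge_average_def sum_nonneg)
qed

lemma not_rings_at_if_no_increment:
  assumes "mono_on {0..} c" "0 \<le> s" "c t \<le> c s" "u \<in> {s<..t}"
  shows "\<not> rings_at c u"
proof
  assume "rings_at c u"
  then have "c s < c u" using assms by (auto simp: rings_at_def)
  moreover have "c u \<le> c t" using assms by (auto intro: mono_onD)
  ultimately show False using assms by simp
qed

text \<open>The jump time is the infimum of the times at which the count has already increased. An
  integer-valued right-continuous path is locally constant to the right, so the infimum is attained
  and is itself a ring.\<close>

lemma unit_increment_jump:
  fixes c :: "real \<Rightarrow> nat"
  assumes mono: "mono_on {0..} c" and rc: "\<And>r. 0 \<le> r \<Longrightarrow> continuous (at_right r) c"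
    and st: "0 \<le> s" "s < t" and incr: "c t = Suc (c s)"
  obtains u where "s < u" "u \<le> t" "rings_at c u"
    "\<And>r. s \<le> r \<Longrightarrow> r < u \<Longrightarrow> c r = c s" "\<And>r. u \<le> r \<Longrightarrow> r \<le> t \<Longrightarrow> c r = c t"
proof -
  define S where "S = {r. s \<le> r \<and> r \<le> t \<and> c s < c r}"
  have bdd: "bdd_below S" by (auto simp: S_def intro: bdd_belowI)
  have tS: "t \<in> S" using st incr by (auto simp: S_def)
  define u where "u = Inf S"
  have su: "s \<le> u" unfolding u_def using tS by (intro cInf_greatest) (auto simp: S_def)
  have ut: "u \<le> t" unfolding u_def by (rule cInf_lower[OF tS bdd])
  have before: "c r = c s" if "s \<le> r" "r < u" for r
  proof -
    have "r \<notin> S" using that(2) cInf_lower[OF _ bdd, of r] unfolding u_def by linarith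
    then have "c r \<le> c s" using that ut by (auto simp: S_def)
    moreover have "c s \<le> c r" using that st by (intro mono_onD[OF mono]) auto
    ultimately show ?thesis by simp
  qed
  have cu: "c s < c u"
  proof (rule ccontr)
    assume "\<not> c s < c u"
    moreover have "c s \<le> c u" using su st by (intro mono_onD[OF mono]) auto
    ultimately have eq: "c u = c s" by simp
    have "((\<lambda>r. c r) \<longlongrightarrow> c u) (at_right u)"
      using rc[of u] su st unfolding continuous_within by auto
    then have "eventually (\<lambda>r. c r = c u) (at_right u)" by (simp add: tendsto_discrete)
    then obtain b where b: "b > u" "\<And>r. u < r \<Longrightarrow> r < b \<Longrightarrow> c r = c u"
      unfolding eventually_at_right_field by auto
    obtain r where r: "r \<in> S" "r < b"
      using b(1) tS cInf_less_iff[OF _ bdd, of b] unfolding u_def by auto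
    have "u \<le> r" using cInf_lower[OF r(1) bdd] by (simp add: u_def)
    then have "c r = c s" using b(2)[of r] eq r(2) by (cases "r = u") auto
    then show False using r(1) by (simp add: S_def)
  qed
  have "c r = c t" if "u \<le> r" "r \<le> t" for r
  proof -
    have "c u \<le> c r" "c r \<le> c t" using that su st by (auto intro!: mono_onD[OF mono])
    then show ?thesis using cu incr by simp
  qed
  moreover have "s < u" using su cu by (cases "s = u") auto
  moreover have "rings_at c u"
    unfolding rings_at_def
  proof safe
    show "0 < u" using \<open>s < u\<close> st by simp
    fix r assume r: "r \<in> {0..<u}"
    have "c r \<le> c (max r s)" using r st by (intro mono_onD[OF mono]) auto
    also have "\<dots> = c s" using r \<open>s < u\<close> by (intro before) auto
    finally show "c r < c u" using cu by simp
  qed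
  ultimately show ?thesis using that ut before by blast
qed

text \<open>If the interval contains one ring in all, \<open>\<eta>\<close> is frozen before the
  jump time \<open>u\<close>, so the values that the jump rule sees just before \<open>u\<close> all
  equal \<open>\<eta> s\<close>; after \<open>u\<close> it is frozen again up to
  \<open>t\<close>.\<close>

lemma averaging_path_step:
  fixes c :: "'v set \<Rightarrow> real \<Rightarrow> nat" and \<eta> :: "real \<Rightarrow> 'v \<Rightarrow> real"
  assumes mono: "\<And>e. e \<in> E \<Longrightarrow> mono_on {0..} (c e)"
    and rc: "\<And>e r. e \<in> E \<Longrightarrow> 0 \<le> r \<Longrightarrow> continuous (at_right r) (c e)"
    and still: "\<And>s t. 0 \<le> s \<Longrightarrow> s < t \<Longrightarrow>
      \<forall>e\<in>E. \<forall>u\<in>{s<..t}. \<not> rings_at (c e) u \<Longrightarrow> \<eta> t = \<eta> s"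
    and jump: "\<And>t x y. {x, y} \<in> E \<Longrightarrow> rings_at (c {x, y}) t \<Longrightarrow>
      \<forall>\<^sub>F r in at_left t. \<eta> t = average_edge x y (\<eta> r)"
    and E: "E \<subseteq> edges_on V" and st: "0 \<le> s" "s < t"
    and z: "z \<in> insert None (Some ` E)" "\<And>e. e \<in> E \<Longrightarrow> c e t - c e s = of_bool (z = Some e)"
  shows "\<eta> t = ring_step z (\<eta> s)"
proof (cases z)
  case None
  have "\<not> rings_at (c e) u" if "e \<in> E" "u \<in> {s<..t}" for e u
    by (rule not_rings_at_if_no_increment[OF mono[OF that(1)] st(1) _ that(2)])
       (use z(2)[OF that(1)] None in simp)
  then show ?thesis using still[OF st] None by simp
next
  case (Some f)
  then have f: "f \<in> E" using z by auto
  then obtain x y where xy: "f = {x, y}" "x \<noteq> y" using E by (auto simp: edges_on_def)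
  have "c f t = Suc (c f s)" using z(2)[OF f] Some by simp
  from unit_increment_jump[OF mono[OF f] rc[OF f] st this]
  obtain u where u: "s < u" "u \<le> t" "rings_at (c f) u"
    "\<And>r. s \<le> r \<Longrightarrow> r < u \<Longrightarrow> c f r = c f s" "\<And>r. u \<le> r \<Longrightarrow> r \<le> t \<Longrightarrow> c f r = c f t"
    by metis
  have flat: "c e b \<le> c e a" if "e \<in> E" "e \<noteq> f" "s \<le> a" "a \<le> b" "b \<le> t" for e a b
  proof -
    have "c e s \<le> c e a" "c e b \<le> c e t"
      using that st by (auto intro!: mono_onD[OF mono[OF that(1)]])
    moreover have "c e t \<le> c e s" using z(2)[OF that(1)] that(2) Some by simp
    ultimately show ?thesis by simp
  qed
  have still': "\<eta> b = \<eta> a" if "s \<le> a" "a \<le> b" "b \<le> t" "c f b \<le> c f a" for a b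
  proof (cases "a = b")
    case False
    have "\<not> rings_at (c e) r" if "e \<in> E" "r \<in> {a<..b}" for e r
    proof (rule not_rings_at_if_no_increment[OF mono[OF that(1)] _ _ that(2)])
      show "0 \<le> a" using \<open>s \<le> a\<close> st by simp
      show "c e b \<le> c e a"
        using flat[OF that(1), of a b] \<open>s \<le> a\<close> \<open>a \<le> b\<close> \<open>b \<le> t\<close> \<open>c f b \<le> c f a\<close>
        by (cases "e = f") auto
    qed
    then show ?thesis using still[of a b] that False st by force
  qed simp
  have "\<eta> t = \<eta> u" using u(1,2) u(5)[of u] by (intro still') auto
  moreover have "\<forall>\<^sub>F r in at_left u. \<eta> u = average_edge x y (\<eta> s)"
  proof -
    have "\<forall>\<^sub>F r in at_left u. \<eta> u = average_edge x y (\<eta> r)"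
      using jump[of x y u] f u(3) xy by simp
    moreover have "\<forall>\<^sub>F r in at_left u. \<eta> r = \<eta> s"
      using eventually_at_left_real[OF u(1)]
    proof eventually_elim
      case (elim r)
      then show ?case using u(2) u(4)[of r] by (intro still') auto
    qed
    ultimately show ?thesis by eventually_elim simp
  qed
  \<comment> \<open>The statement under the filter no longer mentions \<open>r\<close>, and
    \<open>at_left u\<close> is a nontrivial filter, so it holds outright.\<close>
  then have "\<eta> u = average_edge x y (\<eta> s)" by simp
  ultimately show ?thesis using average_edge_eq[OF xy(2)] xy(1) Some by simp
qed

section \<open>Expectations along fine partitions\<close>

text \<open>The law of an increment is prescribed only for \<open>s < t\<close>, hence the strict
  monotonicity of \<open>\<tau>\<close>; \<open>0 < k\<close> makes the index set nonempty, as the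
  product rule for independent variables demands.\<close>

lemma (in prob_space) prob_poisson_clock_increments:
  assumes N: "poisson_clock M N" and \<tau>: "0 \<le> \<tau> 0" "strict_mono \<tau>" and k: "0 < k"
  shows "prob {\<omega> \<in> space M. \<forall>i<k. N (\<tau> (Suc i)) \<omega> - N (\<tau> i) \<omega> = c i} =
    (\<Prod>i<k. pmf (poisson_pmf (\<tau> (Suc i) - \<tau> i)) (c i))"
proof -
  define Y where "Y = (\<lambda>i \<omega>. N (\<tau> (Suc i)) \<omega> - N (\<tau> i) \<omega>)"
  have pos: "0 \<le> \<tau> i" for i
    using \<tau> strict_mono_less_eq[OF \<tau>(2), of 0 i] by simp
  have less: "\<tau> i < \<tau> (Suc i)" for i using \<tau>(2) by (simp add: strict_mono_Suc_iff)
  have indep: "indep_vars (\<lambda>_. count_space UNIV) Y {..<k}"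
    using N \<tau> strict_mono_mono[OF \<tau>(2)] by (auto simp: poisson_clock_def Y_def)
  have "{\<omega> \<in> space M. \<forall>i<k. Y i \<omega> = c i} = (\<Inter>i\<in>{..<k}. Y i -` {c i} \<inter> space M)"
    using k by auto
  also have "prob \<dots> = (\<Prod>i<k. prob (Y i -` {c i} \<inter> space M))"
    using k by (intro indep_varsD_finite[OF indep]) auto
  also have "\<dots> = (\<Prod>i<k. pmf (poisson_pmf (\<tau> (Suc i) - \<tau> i)) (c i))"
  proof (intro prod.cong refl)
    fix i assume i: "i \<in> {..<k}"
    have "Y i \<in> measurable M (count_space UNIV)" using indep i by (auto simp: indep_vars_def)
    then have "prob (Y i -` {c i} \<inter> space M) = measure (distr M (count_space UNIV) (Y i)) {c i}"
      by (simp add: measure_distr)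
    also have "distr M (count_space UNIV) (Y i) = measure_pmf (poisson_pmf (\<tau> (Suc i) - \<tau> i))"
      using N pos less by (simp add: poisson_clock_def Y_def)
    finally show "prob (Y i -` {c i} \<inter> space M) = pmf (poisson_pmf (\<tau> (Suc i) - \<tau> i)) (c i)"
      by (simp add: measure_pmf_single)
  qed
  finally show ?thesis by (simp add: Y_def)
qed

text \<open>Clocks are independent as whole paths, so a prescription of finitely many increments of
  one clock is turned into a measurable set \<open>B e\<close> of the path space. Independence
  across clocks, then across intervals, factorises the probability.\<close>

lemma (in prob_space)
  assumes N: "poisson_clocks M E N" and E: "finite E" "E \<noteq> {}"
    and \<tau>: "0 \<le> \<tau> 0" "strict_mono \<tau>" and k: "0 < k"
  shows sets_poisson_clocks_increments:
      "{\<omega> \<in> space M. \<forall>e\<in>E. \<forall>i<k. N e (\<tau> (Suc i)) \<omega> - N e (\<tau> i) \<omega> = c e i} \<in> events" (is "?A \<in> _")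
    and prob_poisson_clocks_increments:
      "prob {\<omega> \<in> space M. \<forall>e\<in>E. \<forall>i<k. N e (\<tau> (Suc i)) \<omega> - N e (\<tau> i) \<omega> = c e i} =
       (\<Prod>e\<in>E. \<Prod>i<k. pmf (poisson_pmf (\<tau> (Suc i) - \<tau> i)) (c e i))"
proof -
  define P :: "(real \<Rightarrow> nat) measure" where "P = PiM {0..} (\<lambda>_. count_space UNIV)"
  define X where "X = (\<lambda>e \<omega>. \<lambda>t\<in>{0..}. N e t \<omega>)"
  define B where "B = (\<lambda>e. {f \<in> space P. \<forall>i\<in>{..<k}. f (\<tau> (Suc i)) - f (\<tau> i) = c e i})"
  have pos: "0 \<le> \<tau> i" for i
    using \<tau> strict_mono_less_eq[OF \<tau>(2), of 0 i] by simp
  have clock: "poisson_clock M (N e)" if "e \<in> E" for e using N that by (simp add: poisson_clocks_def)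
  have indep: "indep_vars (\<lambda>_. P) X E" using N by (simp add: poisson_clocks_def X_def P_def)
  have B: "B e \<in> sets P" for e
    unfolding B_def
  proof (intro sets.sets_Collect_finite_All finite_lessThan)
    fix i
    have comp: "(\<lambda>f. f (\<tau> j)) \<in> measurable P (count_space UNIV)" for j
      unfolding P_def using pos by (intro measurable_component_singleton) simp
    \<comment> \<open>Measurability of the difference follows by countability: the earlier
      coordinate is frozen at each of its countably many values \<open>l\<close>.\<close>
    have "(\<lambda>f. f (\<tau> (Suc i)) - l) \<in> measurable P (count_space UNIV)" for l
      by (rule measurable_compose[OF comp]) simp
    then have "(\<lambda>f. f (\<tau> (Suc i)) - f (\<tau> i)) \<in> measurable P (count_space UNIV)"
      using comp by (rule measurable_compose_countable)
    then have "(\<lambda>f. f (\<tau> (Suc i)) - f (\<tau> i)) -` {c e i} \<inter> space P \<in> sets P"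
      by (rule measurable_sets) simp
    then show "{f \<in> space P. f (\<tau> (Suc i)) - f (\<tau> i) = c e i} \<in> sets P"
      by (simp add: vimage_def Int_def conj_commute)
  qed
  have XB: "X e -` B e \<inter> space M = {\<omega> \<in> space M. \<forall>i<k. N e (\<tau> (Suc i)) \<omega> - N e (\<tau> i) \<omega> = c e i}"
    for e using pos by (auto simp: X_def B_def P_def space_PiM)
  have A: "?A = (\<Inter>e\<in>E. X e -` B e \<inter> space M)" unfolding XB using E by auto
  have "X e -` B e \<inter> space M \<in> events" if "e \<in> E" for e
    using indep that B by (auto simp: indep_vars_def intro: measurable_sets)
  then show "?A \<in> events" unfolding A using E by (intro sets.finite_INT) auto
  have "prob (\<Inter>e\<in>E. X e -` B e \<inter> space M) = (\<Prod>e\<in>E. prob (X e -` B e \<inter> space M))"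
    by (rule indep_varsD_finite[OF indep]) (use E B in auto)
  also have "\<dots> = (\<Prod>e\<in>E. \<Prod>i<k. pmf (poisson_pmf (\<tau> (Suc i) - \<tau> i)) (c e i))"
    unfolding XB by (intro prod.cong refl prob_poisson_clock_increments clock \<tau> k)
  finally show "prob ?A = (\<Prod>e\<in>E. \<Prod>i<k. pmf (poisson_pmf (\<tau> (Suc i) - \<tau> i)) (c e i))"
    unfolding A .
qed

text \<open>One interval of length \<open>h\<close>, restricted to the events that no clock or exactly one clock rings, which
  have probabilities \<open>exp (- |E| h)\<close> and \<open>h exp (- |E| h)\<close> per edge. The lost mass is \<open>O(h\<^sup>2)\<close>, so that
  only upper bounds for nonnegative functions survive the limit of fine partitions.\<close>

definition euler_step ::
    "'v set set \<Rightarrow> real \<Rightarrow> (('v \<Rightarrow> real) \<Rightarrow> real) \<Rightarrow> ('v \<Rightarrow> real) \<Rightarrow> real" where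
  "euler_step E h F \<eta> = exp (- (real (card E) * h)) * (F \<eta> + h * (\<Sum>e\<in>E. F (edge_average e \<eta>)))"

text \<open>The operators are composed in backward order: the last interval acts on \<open>F\<close>
  first, and the outermost operator belongs to the first interval.\<close>

fun euler_steps ::
    "'v set set \<Rightarrow> (nat \<Rightarrow> real) \<Rightarrow> nat \<Rightarrow> (('v \<Rightarrow> real) \<Rightarrow> real) \<Rightarrow> ('v \<Rightarrow> real) \<Rightarrow> real" where
  "euler_steps E h 0 F = F"
| "euler_steps E h (Suc k) F = euler_steps E h k (euler_step E (h k) F)"

text \<open>The probability of one letter when the edges have independent Poisson counts of mean
  \<open>h\<close>; see \<open>prod_poisson_eq_ring_weight\<close>.\<close>

definition ring_weight :: "'v set set \<Rightarrow> real \<Rightarrow> 'v set option \<Rightarrow> real" where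
  "ring_weight E h r = exp (- (real (card E) * h)) * (if r = None then 1 else h)"

lemma euler_step_eq_sum:
  assumes "finite E"
  shows "euler_step E h F \<eta> = (\<Sum>r\<in>insert None (Some ` E). ring_weight E h r * F (ring_step r \<eta>))"
  using assms
  by (simp add: euler_step_def ring_weight_def sum.reindex sum_distrib_left algebra_simps)

lemma ring_steps_cong: "(\<And>i. i < k \<Longrightarrow> z i = z' i) \<Longrightarrow> ring_steps z k \<eta> = ring_steps z' k \<eta>"
  by (induction k) auto

lemma sum_PiE_lessThan_Suc:
  assumes "finite R"
  shows "(\<Sum>z\<in>PiE {..<Suc k} (\<lambda>_. R). g z) = (\<Sum>z\<in>PiE {..<k} (\<lambda>_. R). \<Sum>r\<in>R. g (z(k := r)))"
proof -
  have "(\<Sum>z\<in>PiE {..<Suc k} (\<lambda>_. R). g z) = (\<Sum>(r, z)\<in>R \<times> PiE {..<k} (\<lambda>_. R). g (z(k := r)))"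
    unfolding lessThan_Suc PiE_insert_eq
    using inj_combinator[of k "{..<k}" "\<lambda>_. R"]
    by (subst sum.reindex) (simp_all add: case_prod_unfold)
  also have "\<dots> = (\<Sum>z\<in>PiE {..<k} (\<lambda>_. R). \<Sum>r\<in>R. g (z(k := r)))"
    by (simp add: sum.cartesian_product[symmetric] sum.swap[of _ R])
  finally show ?thesis .
qed

text \<open>Path expansion over all words of length \<open>k\<close>. In this form the iterated
  operator can be compared with the probabilities of clock events.\<close>

lemma euler_steps_eq_sum:
  assumes E: "finite E"
  shows "euler_steps E h k F \<eta> = (\<Sum>z\<in>PiE {..<k} (\<lambda>_. insert None (Some ` E)).
    (\<Prod>i<k. ring_weight E (h i) (z i)) * F (ring_steps z k \<eta>))"
proof (induction k arbitrary: F)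
  case 0
  then show ?case by simp
next
  case (Suc k)
  let ?R = "insert None (Some ` E)"
  have "euler_steps E h (Suc k) F \<eta> = (\<Sum>z\<in>PiE {..<k} (\<lambda>_. ?R).
      (\<Prod>i<k. ring_weight E (h i) (z i)) *
      (\<Sum>r\<in>?R. ring_weight E (h k) r * F (ring_step r (ring_steps z k \<eta>))))"
    using Suc.IH by (simp only: euler_steps.simps euler_step_eq_sum[OF E])
  also have "\<dots> = (\<Sum>z\<in>PiE {..<k} (\<lambda>_. ?R). \<Sum>r\<in>?R.
      (\<Prod>i<Suc k. ring_weight E (h i) ((z(k := r)) i)) * F (ring_steps (z(k := r)) (Suc k) \<eta>))"
  proof (intro sum.cong refl)
    fix z assume "z \<in> PiE {..<k} (\<lambda>_. ?R)"
    have "ring_steps (z(k := r)) k \<eta> = ring_steps z k \<eta>" for r by (rule ring_steps_cong) simp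
    moreover have "(\<Prod>i<k. ring_weight E (h i) ((z(k := r)) i)) = (\<Prod>i<k. ring_weight E (h i) (z i))" for r
      by (rule prod.cong) auto
    ultimately show "(\<Prod>i<k. ring_weight E (h i) (z i)) *
        (\<Sum>r\<in>?R. ring_weight E (h k) r * F (ring_step r (ring_steps z k \<eta>))) = (\<Sum>r\<in>?R.
        (\<Prod>i<Suc k. ring_weight E (h i) ((z(k := r)) i)) * F (ring_steps (z(k := r)) (Suc k) \<eta>))"
      by (simp only: ring_steps.simps prod.lessThan_Suc fun_upd_same sum_distrib_left mult.assoc)
  qed
  also have "\<dots> = (\<Sum>z\<in>PiE {..<Suc k} (\<lambda>_. ?R).
      (\<Prod>i<Suc k. ring_weight E (h i) (z i)) * F (ring_steps z (Suc k) \<eta>))"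
    by (rule sum_PiE_lessThan_Suc[symmetric]) (use E in simp)
  finally show ?case .
qed

lemma prod_poisson_eq_ring_weight:
  assumes "finite E" "0 < h" "r \<in> insert None (Some ` E)"
  shows "(\<Prod>e\<in>E. pmf (poisson_pmf h) (of_bool (r = Some e))) = ring_weight E h r"
proof -
  have "(\<Prod>e\<in>E. pmf (poisson_pmf h) (of_bool (r = Some e))) =
      (\<Prod>e\<in>E. (if r = Some e then h else 1) * exp (- h))"
    using assms(2) by (intro prod.cong) auto
  also have "\<dots> = (\<Prod>e\<in>E. if r = Some e then h else 1) * exp (- h) ^ card E"
    by (simp add: prod.distrib)
  also have "(\<Prod>e\<in>E. if r = Some e then h else 1) = (if r = None then 1 else h)"
    using assms by (cases r) (auto simp: prod.delta' prod.delta)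
  also have "exp (- h) ^ card E = exp (- (real (card E) * h))"
    by (simp add: exp_of_nat_mult[symmetric])
  finally show ?thesis by (simp add: ring_weight_def mult.commute)
qed

lemma one_minus_prod_le_sum:
  fixes f :: "'i \<Rightarrow> real"
  assumes "finite I" "\<And>i. i \<in> I \<Longrightarrow> 0 \<le> f i" "\<And>i. i \<in> I \<Longrightarrow> f i \<le> 1"
  shows "1 - (\<Prod>i\<in>I. f i) \<le> (\<Sum>i\<in>I. 1 - f i)"
  using assms
proof (induction I)
  case (insert a I)
  have "(\<Prod>i\<in>I. f i) \<le> 1" using insert.prems by (intro prod_le_1) auto
  then have "(1 - f a) * (\<Prod>i\<in>I. f i) \<le> 1 - f a"
    using insert.prems by (simp add: mult_left_le)
  with insert show ?case by (simp add: algebra_simps)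
qed simp

lemma euler_steps_const: "finite E \<Longrightarrow>
  euler_steps E h k (\<lambda>_. c) \<eta> = (\<Prod>i<k. exp (- (real (card E) * h i)) * (1 + real (card E) * h i)) * c"
  by (induction k arbitrary: c) (simp_all add: euler_step_def[abs_def] algebra_simps)

text \<open>\<open>exp (- x) * (1 + x)\<close> is the probability that a Poisson variable of mean
  \<open>x\<close> is at most 1. In use, \<open>x\<close> is the total ring rate times the step
  length, and the loss is quadratic in it.\<close>

lemma exp_minus_mult_one_plus:
  fixes x :: real assumes "0 \<le> x"
  shows "exp (- x) * (1 + x) \<le> 1" "1 - x\<^sup>2 \<le> exp (- x) * (1 + x)"
proof -
  have "1 + x \<le> exp x" by (rule exp_ge_add_one_self)
  then have "exp (- x) * (1 + x) \<le> exp (- x) * exp x" by (intro mult_left_mono) auto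
  then show "exp (- x) * (1 + x) \<le> 1" by (simp add: exp_minus)
  have "1 + (- x) \<le> exp (- x)" by (rule exp_ge_add_one_self)
  then have "(1 - x) * (1 + x) \<le> exp (- x) * (1 + x)" using assms by (intro mult_right_mono) auto
  then show "1 - x\<^sup>2 \<le> exp (- x) * (1 + x)" by (simp add: algebra_simps power2_eq_square)
qed

text \<open>The exceptional null set comes only from path regularity and the jump rule, so one null
  set serves all \<open>k\<close> and all words \<open>z\<close>. On a good path the claim is a
  deterministic induction over the intervals.\<close>

lemma averaging_process_path:
  assumes proc: "averaging_process V E \<xi> M \<eta>" and E: "finite E" "E \<subseteq> edges_on V"
    and \<tau>: "\<tau> 0 = 0" "strict_mono \<tau>"
  obtains N where "poisson_clocks M E N"
    "AE \<omega> in M. \<forall>k z. (\<forall>i<k. z i \<in> insert None (Some ` E)) \<longrightarrow>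
       (\<forall>e\<in>E. \<forall>i<k. N e (\<tau> (Suc i)) \<omega> - N e (\<tau> i) \<omega> = of_bool (z i = Some e)) \<longrightarrow>
       \<eta> (\<tau> k) \<omega> = ring_steps z k \<xi>"
proof -
  obtain N where N: "poisson_clocks M E N" and AE1: "AE \<omega> in M. \<eta> 0 \<omega> = \<xi> \<and>
          (\<forall>s t. 0 \<le> s \<longrightarrow> s < t \<longrightarrow>
             (\<forall>e\<in>E. \<forall>u\<in>{s<..t}. \<not> rings_at (\<lambda>r. N e r \<omega>) u) \<longrightarrow> \<eta> t \<omega> = \<eta> s \<omega>) \<and>
          (\<forall>t x y. {x, y} \<in> E \<longrightarrow> rings_at (\<lambda>r. N {x, y} r \<omega>) t \<longrightarrow>
             (\<forall>\<^sub>F r in at_left t. \<eta> t \<omega> = average_edge x y (\<eta> r \<omega>)))"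
    using proc unfolding averaging_process_def by blast
  have "AE \<omega> in M. \<forall>e\<in>E. mono_on {0..} (\<lambda>t. N e t \<omega>) \<and>
        (\<forall>t\<ge>0. continuous (at_right t) (\<lambda>s. N e s \<omega>))"
    using N by (intro AE_finite_allI E(1)) (auto simp: poisson_clocks_def poisson_clock_def)
  with AE1 have "AE \<omega> in M. \<forall>k z. (\<forall>i<k. z i \<in> insert None (Some ` E)) \<longrightarrow>
       (\<forall>e\<in>E. \<forall>i<k. N e (\<tau> (Suc i)) \<omega> - N e (\<tau> i) \<omega> = of_bool (z i = Some e)) \<longrightarrow>
       \<eta> (\<tau> k) \<omega> = ring_steps z k \<xi>"
  proof eventually_elim
    case (elim \<omega>)
    show ?case
    proof (intro allI impI)
      fix k z
      assume "\<forall>i<k. z i \<in> insert None (Some ` E)"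
        and "\<forall>e\<in>E. \<forall>i<k. N e (\<tau> (Suc i)) \<omega> - N e (\<tau> i) \<omega> = of_bool (z i = Some e)"
      then show "\<eta> (\<tau> k) \<omega> = ring_steps z k \<xi>"
      proof (induction k)
        case 0
        then show ?case using elim \<tau> by simp
      next
        case (Suc k)
        have "\<eta> (\<tau> (Suc k)) \<omega> = ring_step (z k) (\<eta> (\<tau> k) \<omega>)"
        proof (rule averaging_path_step[where c = "\<lambda>e r. N e r \<omega>" and \<eta> = "\<lambda>r. \<eta> r \<omega>", OF _ _ _ _ E(2)])
          show "0 \<le> \<tau> k" using \<tau> strict_mono_less_eq[OF \<tau>(2), of 0 k] by simp
          show "\<tau> k < \<tau> (Suc k)" using \<tau>(2) by (simp add: strict_mono_Suc_iff)
        qed (use elim Suc.prems in auto)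
        moreover have "\<eta> (\<tau> k) \<omega> = ring_steps z k \<xi>"
          by (rule Suc.IH) (use Suc.prems in auto)
        ultimately show ?case by simp
      qed
    qed
  qed
  with N that show ?thesis by blast
qed

text \<open>The events \<open>A z\<close>, one per word, are disjoint and each determines
  \<open>\<eta> t\<close>. Their contribution is exactly \<open>euler_steps\<close>; on the rest,
  where some interval sees several rings, \<open>F\<close> is bounded by \<open>B\<close>.\<close>

theorem averaging_process_expectation_le_euler_steps:
  assumes proc: "averaging_process V E \<xi> M \<eta>" and E: "finite E" "E \<noteq> {}" "E \<subseteq> edges_on V"
    and F: "\<And>\<zeta>. \<zeta> \<in> prob_mass_functions V \<Longrightarrow> 0 \<le> F \<zeta>" "\<And>\<zeta>. \<zeta> \<in> prob_mass_functions V \<Longrightarrow> F \<zeta> \<le> B"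
    and meas: "(\<lambda>\<omega>. F (\<eta> t \<omega>)) \<in> borel_measurable M"
    and h: "\<And>i. 0 < h i" and t: "t = (\<Sum>i<k. h i)" and k: "0 < k"
  shows "(\<integral>\<omega>. F (\<eta> t \<omega>) \<partial>M) \<le> euler_steps E h k F \<xi> + B * (\<Sum>i<k. (real (card E) * h i)\<^sup>2)"
proof -
  interpret prob_space M using proc by (simp add: averaging_process_def)
  define \<tau> where "\<tau> = (\<lambda>j. \<Sum>i<j. h i)"
  have \<tau>: "\<tau> 0 = 0" "strict_mono \<tau>" "\<And>i. \<tau> (Suc i) - \<tau> i = h i" "t = \<tau> k"
    using h by (auto simp: \<tau>_def strict_mono_Suc_iff t)
  have t0: "0 \<le> t" unfolding t using h by (intro sum_nonneg) (simp add: less_imp_le)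
  have in_pmf: "\<eta> t \<omega> \<in> prob_mass_functions V" if "\<omega> \<in> space M" for \<omega>
    using proc that t0 by (auto simp: averaging_process_def)
  obtain \<omega>0 where "\<omega>0 \<in> space M" using not_empty by auto
  then have B0: "0 \<le> B" using F[OF in_pmf[of \<omega>0]] by simp
  obtain N where N: "poisson_clocks M E N" and path: "AE \<omega> in M. \<forall>k z.
       (\<forall>i<k. z i \<in> insert None (Some ` E)) \<longrightarrow>
       (\<forall>e\<in>E. \<forall>i<k. N e (\<tau> (Suc i)) \<omega> - N e (\<tau> i) \<omega> = of_bool (z i = Some e)) \<longrightarrow>
       \<eta> (\<tau> k) \<omega> = ring_steps z k \<xi>"
    by (rule averaging_process_path[OF proc E(1,3) \<tau>(1,2)])
  define Z where "Z = PiE {..<k} (\<lambda>_. insert None (Some ` E))"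
  define A where "A = (\<lambda>z. {\<omega> \<in> space M. \<forall>e\<in>E. \<forall>i<k.
      N e (\<tau> (Suc i)) \<omega> - N e (\<tau> i) \<omega> = of_bool (z i = Some e)})"
  have finZ: "finite Z" unfolding Z_def using E(1) by (intro finite_PiE) auto
  have A_sets: "A z \<in> events" for z
    unfolding A_def by (rule sets_poisson_clocks_increments[OF N E(1,2) _ _ k]) (use \<tau> in auto)
  have A_prob: "prob (A z) = (\<Prod>i<k. ring_weight E (h i) (z i))" if "z \<in> Z" for z
  proof -
    have "prob (A z) = (\<Prod>e\<in>E. \<Prod>i<k. pmf (poisson_pmf (\<tau> (Suc i) - \<tau> i)) (of_bool (z i = Some e)))"
      unfolding A_def by (rule prob_poisson_clocks_increments[OF N E(1,2) _ _ k]) (use \<tau> in auto)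
    also have "\<dots> = (\<Prod>i<k. \<Prod>e\<in>E. pmf (poisson_pmf (h i)) (of_bool (z i = Some e)))"
      unfolding \<tau>(3) by (rule prod.swap)
    also have "\<dots> = (\<Prod>i<k. ring_weight E (h i) (z i))"
      using that h by (intro prod.cong refl prod_poisson_eq_ring_weight E(1)) (auto simp: Z_def)
    finally show ?thesis .
  qed
  have disj: "z = z'" if "z \<in> Z" "z' \<in> Z" "\<omega> \<in> A z" "\<omega> \<in> A z'" for z z' \<omega>
  proof (rule PiE_ext[OF that(1,2)[unfolded Z_def]])
    fix i assume i: "i \<in> {..<k}"
    have "\<forall>e\<in>E. (z i = Some e) = (z' i = Some e)"
    proof
      fix e assume e: "e \<in> E"
      have "N e (\<tau> (Suc i)) \<omega> - N e (\<tau> i) \<omega> = of_bool (z i = Some e)"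
        "N e (\<tau> (Suc i)) \<omega> - N e (\<tau> i) \<omega> = of_bool (z' i = Some e)"
        using that(3,4) e i by (simp_all add: A_def)
      then have "(of_bool (z i = Some e) :: nat) = of_bool (z' i = Some e)" by simp
      then show "(z i = Some e) = (z' i = Some e)" by (simp only: of_bool_eq_iff)
    qed
    moreover have "z i \<in> insert None (Some ` E)" "z' i \<in> insert None (Some ` E)"
      using that(1,2) i by (auto simp: Z_def)
    ultimately show "z i = z' i" by fastforce
  qed
  let ?f = "\<lambda>z. F (ring_steps z k \<xi>)"
  \<comment> \<open>One formula for both cases: on \<open>A z\<close> the right side is the value of
    \<open>F\<close> at the end of the word \<open>z\<close>, and outside all these events it is
    \<open>B\<close>.\<close>
  have "AE \<omega> in M. F (\<eta> t \<omega>) \<le> B + (\<Sum>z\<in>Z. (?f z - B) * indicator (A z) \<omega>)"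
    using path AE_space
  proof eventually_elim
    case (elim \<omega>)
    show ?case
    proof (cases "\<exists>z\<in>Z. \<omega> \<in> A z")
      case True
      then obtain z where z: "z \<in> Z" "\<omega> \<in> A z" by blast
      have "(\<Sum>z'\<in>Z. (?f z' - B) * indicator (A z') \<omega>) = (\<Sum>z'\<in>Z. if z' = z then ?f z - B else 0)"
      proof (intro sum.cong refl)
        fix z' assume "z' \<in> Z"
        then have "\<omega> \<in> A z' \<longleftrightarrow> z' = z" using disj[OF _ z(1) _ z(2)] z(2) by metis
        then show "(?f z' - B) * indicator (A z') \<omega> = (if z' = z then ?f z - B else 0)" using z(2) by auto
      qed
      also have "\<dots> = ?f z - B" using z finZ by simp
      finally have "B + (\<Sum>z'\<in>Z. (?f z' - B) * indicator (A z') \<omega>) = ?f z" by simp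
      moreover have "\<eta> t \<omega> = ring_steps z k \<xi>"
      proof -
        have "\<forall>i<k. z i \<in> insert None (Some ` E)"
          using z(1) unfolding Z_def by (metis PiE_mem lessThan_iff)
        moreover have "\<forall>e\<in>E. \<forall>i<k. N e (\<tau> (Suc i)) \<omega> - N e (\<tau> i) \<omega> = of_bool (z i = Some e)"
          using z(2) unfolding A_def mem_Collect_eq by (rule conjunct2)
        ultimately show ?thesis using elim(1) unfolding \<tau>(4) by metis
      qed
      ultimately show ?thesis by simp
    next
      case False
      then have "(\<Sum>z\<in>Z. (?f z - B) * indicator (A z) \<omega>) = 0" by (intro sum.neutral) auto
      then show ?thesis using F(2)[OF in_pmf[OF elim(2)]] by simp
    qed
  qed
  moreover have "integrable M (\<lambda>\<omega>. F (\<eta> t \<omega>))"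
    using meas F in_pmf by (intro integrable_const_bound[where B = B]) auto
  ultimately have "(\<integral>\<omega>. F (\<eta> t \<omega>) \<partial>M) \<le> (\<integral>\<omega>. B + (\<Sum>z\<in>Z. (?f z - B) * indicator (A z) \<omega>) \<partial>M)"
    using A_sets by (intro integral_mono_AE) (auto intro!: Bochner_Integration.integrable_add Bochner_Integration.integrable_sum
        integrable_mult_right integrable_real_indicator simp: emeasure_eq_measure)
  also have "\<dots> = B + (\<Sum>z\<in>Z. (?f z - B) * prob (A z))"
  proof -
    have ind: "integrable M (\<lambda>\<omega>. (?f z - B) * indicator (A z) \<omega>)" for z
      using A_sets by (intro integrable_mult_right integrable_real_indicator) (auto simp: emeasure_eq_measure)
    have "(\<integral>\<omega>. B + (\<Sum>z\<in>Z. (?f z - B) * indicator (A z) \<omega>) \<partial>M) =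
        (\<integral>\<omega>. B \<partial>M) + (\<Sum>z\<in>Z. \<integral>\<omega>. (?f z - B) * indicator (A z) \<omega> \<partial>M)"
      by (simp only: Bochner_Integration.integral_add[OF integrable_const Bochner_Integration.integrable_sum[OF ind]]
          Bochner_Integration.integral_sum[OF ind])
    then show ?thesis using A_sets by (simp add: prob_space)
  qed
  also have "\<dots> = euler_steps E h k F \<xi> + B * (1 - euler_steps E h k (\<lambda>_. 1) \<xi>)"
    unfolding euler_steps_eq_sum[OF E(1)] Z_def[symmetric]
    by (simp add: A_prob algebra_simps sum_subtractf sum_distrib_left cong: sum.cong)
  \<comment> \<open>Applied to the constant 1, the operator gives the probability that every
    interval has at most one ring.\<close>
  also have "1 - euler_steps E h k (\<lambda>_. 1) \<xi> \<le> (\<Sum>i<k. (real (card E) * h i)\<^sup>2)"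
  proof -
    have h0: "0 \<le> real (card E) * h i" for i using h[of i] by simp
    have "1 - euler_steps E h k (\<lambda>_. 1) \<xi> \<le> (\<Sum>i<k. 1 - exp (- (real (card E) * h i)) * (1 + real (card E) * h i))"
      unfolding euler_steps_const[OF E(1)] mult_1_right
      using exp_minus_mult_one_plus[OF h0] h0 by (intro one_minus_prod_le_sum) auto
    also have "\<dots> \<le> (\<Sum>i<k. (real (card E) * h i)\<^sup>2)"
      using exp_minus_mult_one_plus[OF h0] by (intro sum_mono) (simp add: algebra_simps)
    finally show ?thesis .
  qed
  finally show ?thesis using B0 by (simp add: mult_left_mono)
qed

section \<open>Calculus of the truncated transition operators\<close>

lemma euler_steps_add:
  "euler_steps E h (j + k) F = euler_steps E h j (euler_steps E (\<lambda>i. h (j + i)) k F)"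
  by (induction k arbitrary: F) simp_all

lemma euler_steps_Suc_shift:
  "euler_steps E h (Suc k) F = euler_step E (h 0) (euler_steps E (\<lambda>i. h (Suc i)) k F)"
  using euler_steps_add[of E h 1 k F] by simp

lemma euler_step_mono:
  assumes "finite V" "E \<subseteq> edges_on V" "0 \<le> h" "\<eta> \<in> prob_mass_functions V"
    and "\<And>\<zeta>. \<zeta> \<in> prob_mass_functions V \<Longrightarrow> F \<zeta> \<le> G \<zeta>"
  shows "euler_step E h F \<eta> \<le> euler_step E h G \<eta>"
  unfolding euler_step_def
  using assms by (intro mult_left_mono add_mono sum_mono) (auto intro: edge_average_pmf)

lemma euler_steps_mono:
  assumes "finite V" "E \<subseteq> edges_on V" "\<And>i. 0 \<le> h i" "\<eta> \<in> prob_mass_functions V"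
    and "\<And>\<zeta>. \<zeta> \<in> prob_mass_functions V \<Longrightarrow> F \<zeta> \<le> G \<zeta>"
  shows "euler_steps E h k F \<eta> \<le> euler_steps E h k G \<eta>"
  using assms(5)
proof (induction k arbitrary: F G)
  case (Suc k)
  show ?case unfolding euler_steps.simps
    by (rule Suc.IH) (use Suc.prems assms in \<open>auto intro: euler_step_mono\<close>)
qed (use assms(4) in auto)

lemma euler_step_affine:
  assumes "finite E"
  shows "euler_step E h (\<lambda>\<zeta>. a * F \<zeta> + b) \<eta> =
    a * euler_step E h F \<eta> + b * (exp (- (real (card E) * h)) * (1 + real (card E) * h))"
  by (simp add: euler_step_def sum.distrib sum_distrib_left algebra_simps)

text \<open>Each step has total mass at most 1, so a nonnegative additive constant can only
  shrink.\<close>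

lemma euler_steps_affine_le:
  assumes E: "finite E" and h: "\<And>i. 0 \<le> h i" and b: "0 \<le> b"
  shows "euler_steps E h k (\<lambda>\<zeta>. a * F \<zeta> + b) \<xi> \<le> a * euler_steps E h k F \<xi> + b"
proof -
  have "euler_steps E h k (\<lambda>\<zeta>. a * F \<zeta> + b) \<xi> =
      a * euler_steps E h k F \<xi> + b * (\<Prod>i<k. exp (- (real (card E) * h i)) * (1 + real (card E) * h i))"
    for a b
    by (induction k arbitrary: F a b) (simp_all add: euler_step_affine[OF E, abs_def] mult_ac)
  moreover have "(\<Prod>i<k. exp (- (real (card E) * h i)) * (1 + real (card E) * h i)) \<le> 1"
    using h exp_minus_mult_one_plus(1) by (intro prod_le_1) auto
  ultimately show ?thesis using b by (simp add: mult_left_le)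
qed

text \<open>The Euler step acts on \<open>F\<close> by a factor \<open>r\<close> and moves it towards \<open>c\<close>; iterating keeps the form
  \<open>\<rho> F + (1 - \<rho>) c\<close>.\<close>

lemma euler_steps_drift:
  assumes V: "finite V" "finite E" "E \<subseteq> edges_on V" and h: "\<And>i. 0 \<le> h i"
    and F: "\<And>\<zeta>. \<zeta> \<in> prob_mass_functions V \<Longrightarrow> 0 \<le> F \<zeta>"
    and drift: "\<And>\<zeta>. \<zeta> \<in> prob_mass_functions V \<Longrightarrow>
      (\<Sum>e\<in>E. F (edge_average e \<zeta>) - F \<zeta>) \<le> l * (c - F \<zeta>)"
    and l: "l \<le> real (card E)" and c: "0 \<le> c" and \<xi>: "\<xi> \<in> prob_mass_functions V"
  shows "euler_steps E h k F \<xi> \<le> exp (- (l * (\<Sum>i<k. h i))) * F \<xi> + c"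
proof -
  define d where "d = real (card E)"
  \<comment> \<open>The factor of \<open>F\<close> after one step under the drift inequality.
    \<open>l \<le> d\<close> keeps it nonnegative, and \<open>1 + y \<le> exp y\<close> bounds it by
    \<open>exp (- (l * x))\<close> for either sign of \<open>l\<close>; negative \<open>l\<close> is
    the case of the lower bound.\<close>
  define r where "r = (\<lambda>x. exp (- (d * x)) * (1 + x * (d - l)))"
  have r0: "0 \<le> r x" if "0 \<le> x" for x
    using l that by (simp add: r_def d_def)
  have r1: "r x \<le> exp (- (l * x))" for x
  proof -
    have "1 + x * (d - l) \<le> exp (x * (d - l))" by (rule exp_ge_add_one_self)
    then have "r x \<le> exp (- (d * x)) * exp (x * (d - l))"
      unfolding r_def by (intro mult_left_mono) auto
    also have "\<dots> = exp (- (l * x))" by (simp add: exp_add[symmetric] algebra_simps)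
    finally show ?thesis .
  qed
  have "euler_steps E h k F \<zeta> \<le> (\<Prod>i<k. r (h i)) * F \<zeta> + c * (1 - (\<Prod>i<k. r (h i)))"
    if "\<zeta> \<in> prob_mass_functions V" for \<zeta>
    using that h
  proof (induction k arbitrary: h \<zeta>)
    case (Suc k)
    define \<rho> where "\<rho> = (\<Prod>i<k. r (h (Suc i)))"
    define x where "x = h 0"
    define u where "u = exp (- (d * x))"
    have \<rho>: "0 \<le> \<rho>" unfolding \<rho>_def using Suc.prems r0 by (intro prod_nonneg) auto
    have x: "0 \<le> x" using Suc.prems by (simp add: x_def)
    have u: "0 < u" "u * (1 + d * x) \<le> 1"
      using exp_minus_mult_one_plus(1)[of "d * x"] x by (simp_all add: u_def d_def)
    have "euler_step E x F \<zeta> \<le> u * (F \<zeta> + x * (d * F \<zeta> + l * (c - F \<zeta>)))"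
      unfolding euler_step_def u_def d_def
      using drift[OF Suc.prems(1)] x by (intro mult_left_mono add_left_mono) (auto simp: sum_subtractf)
    also have "\<dots> = r x * F \<zeta> + (u * (1 + d * x) - r x) * c"
      by (simp add: r_def u_def algebra_simps)
    finally have step: "euler_step E x F \<zeta> \<le> r x * F \<zeta> + (u * (1 + d * x) - r x) * c" .
    \<comment> \<open>The first interval is peeled off: the induction hypothesis bounds the
      remaining steps at every configuration, and the first step is applied to that bound.\<close>
    have "euler_steps E h (Suc k) F \<zeta> \<le> euler_step E x (\<lambda>\<zeta>. \<rho> * F \<zeta> + c * (1 - \<rho>)) \<zeta>"
      unfolding euler_steps_Suc_shift x_def[symmetric]
      by (rule euler_step_mono[OF V(1,3) x Suc.prems(1)])
         (use Suc.IH[of _ "\<lambda>i. h (Suc i)"] Suc.prems in \<open>auto simp: \<rho>_def\<close>)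
    also have "\<dots> = \<rho> * euler_step E x F \<zeta> + c * (1 - \<rho>) * (u * (1 + d * x))"
      by (simp add: euler_step_affine[OF V(2)] u_def d_def)
    also have "\<dots> \<le> \<rho> * (r x * F \<zeta> + (u * (1 + d * x) - r x) * c) + c * (1 - \<rho>) * (u * (1 + d * x))"
      using mult_left_mono[OF step \<rho>] by simp
    also have "\<dots> = \<rho> * r x * F \<zeta> + c * (u * (1 + d * x)) - c * (\<rho> * r x)"
      by (simp add: algebra_simps)
    also have "\<dots> \<le> \<rho> * r x * F \<zeta> + c * (1 - \<rho> * r x)"
      using mult_left_mono[OF u(2) c] by (simp add: algebra_simps)
    also have "\<rho> * r x = (\<Prod>i<Suc k. r (h i))"
      unfolding prod.lessThan_Suc_shift \<rho>_def x_def by (simp add: mult.commute)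
    finally show ?case .
  qed simp
  from this[OF \<xi>] have "euler_steps E h k F \<xi> \<le> (\<Prod>i<k. r (h i)) * F \<xi> + c * (1 - (\<Prod>i<k. r (h i)))" .
  also have "\<dots> \<le> exp (- (l * (\<Sum>i<k. h i))) * F \<xi> + c"
  proof (intro add_mono mult_right_mono F[OF \<xi>])
    have "(\<Prod>i<k. r (h i)) \<le> (\<Prod>i<k. exp (- (l * h i)))" using r0 r1 h by (intro prod_mono) auto
    then show "(\<Prod>i<k. r (h i)) \<le> exp (- (l * (\<Sum>i<k. h i)))"
      by (simp add: exp_sum[symmetric] sum_distrib_left sum_negf)
    have "0 \<le> (\<Prod>i<k. r (h i))" using r0 h by (intro prod_nonneg) auto
    then show "c * (1 - (\<Prod>i<k. r (h i))) \<le> c" using c by (simp add: mult_left_le)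
  qed
  finally show ?thesis .
qed

text \<open>Each stage is cut into \<open>n\<close> equal steps; the loss from multiple rings is
  \<open>C / n\<close> and disappears in the limit, which is why \<open>le\<close> ranges over all
  step sequences with the right totals. Two stages leave room for different estimates before and
  after time \<open>t\<close>.\<close>

lemma averaging_process_expectation_le:
  assumes proc: "averaging_process V E \<xi> M \<eta>" and E: "finite E" "E \<noteq> {}" "E \<subseteq> edges_on V"
    and F: "\<And>\<zeta>. \<zeta> \<in> prob_mass_functions V \<Longrightarrow> 0 \<le> F \<zeta>" "\<And>\<zeta>. \<zeta> \<in> prob_mass_functions V \<Longrightarrow> F \<zeta> \<le> B"
    and meas: "(\<lambda>\<omega>. F (\<eta> (t + s) \<omega>)) \<in> borel_measurable M"
    and st: "0 < t" "0 < s"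
    and le: "\<And>h h' j k. (\<And>i. 0 \<le> h i) \<Longrightarrow> (\<And>i. 0 \<le> h' i) \<Longrightarrow> (\<Sum>i<j. h i) = t \<Longrightarrow>
      (\<Sum>i<k. h' i) = s \<Longrightarrow> euler_steps E h j (euler_steps E h' k F) \<xi> \<le> X"
  shows "(\<integral>\<omega>. F (\<eta> (t + s) \<omega>) \<partial>M) \<le> X"
proof -
  define C where "C = B * ((real (card E) * t)\<^sup>2 + (real (card E) * s)\<^sup>2)"
  have bound: "(\<integral>\<omega>. F (\<eta> (t + s) \<omega>) \<partial>M) \<le> X + C / real n" if n: "0 < n" for n
  proof -
    define h where "h = (\<lambda>i. if i < n then t / n else s / n)"
    have h: "0 < h i" for i using n st by (simp add: h_def)
    have split: "(\<Sum>i<n + n. g (h i)) = real n * g (t / n) + real n * g (s / n)" for g :: "real \<Rightarrow> real"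
    proof -
      have "(\<Sum>i<n + n. g (h i)) = (\<Sum>i<n. g (h i)) + (\<Sum>i<n. g (h (n + i)))"
        by (simp only: lessThan_atLeast0 sum.atLeastLessThan_concat[of 0 n "n + n", symmetric]
            le_add1 zero_le sum.shift_bounds_nat_ivl[of _ 0 n n, simplified] add.commute)
      then show ?thesis by (simp add: h_def)
    qed
    have "(\<integral>\<omega>. F (\<eta> (t + s) \<omega>) \<partial>M) \<le>
        euler_steps E h (n + n) F \<xi> + B * (\<Sum>i<n + n. (real (card E) * h i)\<^sup>2)"
      by (rule averaging_process_expectation_le_euler_steps[OF proc E F meas h])
         (use n split[of "\<lambda>x. x"] in auto)
    also have "B * (\<Sum>i<n + n. (real (card E) * h i)\<^sup>2) = C / real n"
      using n unfolding split[of "\<lambda>x. (real (card E) * x)\<^sup>2"] C_def by (simp add: power2_eq_square field_simps)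
    also have "euler_steps E h (n + n) F \<xi> \<le> X"
      unfolding euler_steps_add
      by (rule le) (use st n in \<open>auto simp: h_def\<close>)
    finally show ?thesis by simp
  qed
  have "(\<lambda>n. X + C / real n) \<longlonglongrightarrow> X + 0"
    by (intro tendsto_add tendsto_const lim_const_over_n)
  then show ?thesis
    using bound by (intro LIMSEQ_le_const[where X = "\<lambda>n. X + C / real n"]) (auto intro!: exI[of _ 1])
qed

section \<open>The complete bipartite graph\<close>

lemma complete_bipartite_edges_eq_image:
  "complete_bipartite_edges m k = (\<lambda>(x, y). {x, y}) ` ({0..<m} \<times> {m..<m + k})"
  by (auto simp: complete_bipartite_edges_def) blast

lemma inj_on_bipartite_edge: "inj_on (\<lambda>(x, y). {x, y}) ({0..<m} \<times> {m..<m + k :: nat})"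
  by (auto simp: inj_on_def doubleton_eq_iff)

lemma finite_complete_bipartite_edges: "finite (complete_bipartite_edges m k)"
  by (simp add: complete_bipartite_edges_eq_image)

lemma card_complete_bipartite_edges: "card (complete_bipartite_edges m k) = m * k"
  by (simp add: complete_bipartite_edges_eq_image card_image[OF inj_on_bipartite_edge])

lemma complete_bipartite_edges_subset: "complete_bipartite_edges m k \<subseteq> edges_on {0..<m + k}"
  by (fastforce simp: complete_bipartite_edges_def edges_on_def)

lemma sum_complete_bipartite_edges:
  "(\<Sum>e\<in>complete_bipartite_edges m k. g e) = (\<Sum>x\<in>{0..<m}. \<Sum>y\<in>{m..<m + k}. g {x, y})"
  unfolding complete_bipartite_edges_eq_image sum.reindex[OF inj_on_bipartite_edge]
  by (simp add: sum.cartesian_product case_prod_unfold)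

lemma sum_edge_average_diff:
  fixes \<phi> :: "'v \<Rightarrow> real \<Rightarrow> real"
  assumes "finite V" "x \<in> V" "y \<in> V" "x \<noteq> y"
  shows "(\<Sum>z\<in>V. \<phi> z (edge_average {x, y} \<eta> z)) - (\<Sum>z\<in>V. \<phi> z (\<eta> z)) =
    \<phi> x ((\<eta> x + \<eta> y) / 2) + \<phi> y ((\<eta> x + \<eta> y) / 2) - \<phi> x (\<eta> x) - \<phi> y (\<eta> y)"
proof -
  have *: "(\<Sum>z\<in>V. g z) = g x + g y + (\<Sum>z\<in>V - {x, y}. g z)" for g :: "'v \<Rightarrow> real"
    using assms sum.subset_diff[of "{x, y}" V g] by simp
  have "(\<Sum>z\<in>V - {x, y}. \<phi> z (edge_average {x, y} \<eta> z)) = (\<Sum>z\<in>V - {x, y}. \<phi> z (\<eta> z))"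
    by (intro sum.cong) (auto simp: edge_average_def)
  then show ?thesis
    using assms(4) by (simp add: *[of "\<lambda>z. \<phi> z (\<eta> z)"] *[of "\<lambda>z. \<phi> z (edge_average {x, y} \<eta> z)"])
       (simp add: edge_average_def)
qed

lemma sum_bipartite_parts:
  "(\<Sum>z\<in>{0..<m + k :: nat}. g z) = (\<Sum>x\<in>{0..<m}. g x) + (\<Sum>y\<in>{m..<m + k}. g y)"
  by (simp add: sum.atLeastLessThan_concat)

lemma bipartite_drift_eq:
  fixes \<phi> :: "nat \<Rightarrow> real \<Rightarrow> real"
  shows "(\<Sum>e\<in>complete_bipartite_edges m k.
      (\<Sum>z\<in>{0..<m + k}. \<phi> z (edge_average e \<eta> z)) - (\<Sum>z\<in>{0..<m + k}. \<phi> z (\<eta> z))) =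
    (\<Sum>x\<in>{0..<m}. \<Sum>y\<in>{m..<m + k}.
      \<phi> x ((\<eta> x + \<eta> y) / 2) + \<phi> y ((\<eta> x + \<eta> y) / 2) - \<phi> x (\<eta> x) - \<phi> y (\<eta> y))"
  unfolding sum_complete_bipartite_edges
  by (intro sum.cong refl sum_edge_average_diff) auto

text \<open>To first order in \<open>\<delta>\<close>, \<open>(1, \<rho>)\<close> is the leading eigenvector of the pair of linear inequalities
  satisfied by the two partial sums of \<open>\<eta>\<^sup>p\<close>, where \<open>2 powr (- p) = 1 / 2 - \<delta>\<close>.\<close>

lemma bipartite_weights:
  fixes m k \<delta> :: real
  assumes m: "0 < m" "m \<le> k" and \<delta>: "\<bar>\<delta>\<bar> \<le> 1 / 8"
    and \<rho>: "\<rho> = 1 + 4 * \<delta> * (k - m) / (m + k)"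
    and l: "l \<le> 4 * \<delta> * m * k / (m + k) - 40 * m * \<delta>\<^sup>2"
  shows "1 / 2 \<le> \<rho>" "\<rho> \<le> 3 / 2"
    "k * (\<rho> * (1 / 2 - \<delta>) - (1 / 2 + \<delta>)) \<le> - l"
    "m * ((1 / 2 - \<delta>) - \<rho> * (1 / 2 + \<delta>)) \<le> - (l * \<rho>)"
proof -
  \<comment> \<open>The imbalance of the parts: \<open>1 + v\<close> and \<open>1 - v\<close> are
    twice the proportions of \<open>k\<close> and \<open>m\<close> in \<open>m + k\<close>.\<close>
  define v where "v = (k - m) / (m + k)"
  have v: "0 \<le> v" "v \<le> 1" using m by (simp_all add: v_def)
  have kv: "k = (m + k) * (1 + v) / 2" "m = (m + k) * (1 - v) / 2"
    using m by (simp_all add: v_def field_simps)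
  have kv': "k / (m + k) = (1 + v) / 2" "m / (m + k) = (1 - v) / 2"
    using m by (simp_all add: v_def field_simps)
  have \<rho>': "\<rho> = 1 + 4 * \<delta> * v" by (simp add: \<rho> v_def)
  have "\<bar>\<delta> * v\<bar> \<le> 1 / 8 * 1" unfolding abs_mult using v \<delta> by (intro mult_mono) auto
  then have dv: "\<bar>\<delta> * v\<bar> \<le> 1 / 8" by simp
  then show \<rho>1: "1 / 2 \<le> \<rho>" and "\<rho> \<le> 3 / 2" unfolding \<rho>' by linarith+
  have d2: "0 \<le> m * \<delta>\<^sup>2" using m by simp
  have l': "l \<le> 2 * \<delta> * m * (1 + v) - 40 * m * \<delta>\<^sup>2"
  proof -
    have "4 * \<delta> * m * k / (m + k) = 4 * \<delta> * m * (k / (m + k))" by simp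
    also have "\<dots> = 2 * \<delta> * m * (1 + v)" unfolding kv' by simp
    finally show ?thesis using l by simp
  qed
  have "k * (\<rho> * (1 / 2 - \<delta>) - (1 / 2 + \<delta>)) = - 2 * \<delta> * (k * (1 - v)) - 4 * k * v * \<delta>\<^sup>2"
    unfolding \<rho>' by (simp add: field_simps power2_eq_square)
  also have "k * (1 - v) = m * (1 + v)" using kv by (metis mult.commute mult.left_commute times_divide_eq_left)
  \<comment> \<open>Only errors of order \<open>m * \<delta>\<^sup>2\<close> are affordable, and
    this one has the possibly far larger factor \<open>k\<close>. Its sign is favourable for either
    sign of \<open>\<delta>\<close>, so it is dropped.\<close>
  also have "- 2 * \<delta> * (m * (1 + v)) - 4 * k * v * \<delta>\<^sup>2 \<le> - 2 * \<delta> * (m * (1 + v))"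
    using m v by simp
  also have "\<dots> \<le> - l" using l' d2 by (simp add: algebra_simps)
  finally show "k * (\<rho> * (1 / 2 - \<delta>) - (1 / 2 + \<delta>)) \<le> - l" .
  have "l * \<rho> \<le> (2 * \<delta> * m * (1 + v) - 40 * m * \<delta>\<^sup>2) * \<rho>"
    using l' \<rho>1 by (intro mult_right_mono) auto
  also have "\<dots> = m * (2 * \<delta> * (1 + v) * \<rho> - 40 * \<delta>\<^sup>2 * \<rho>)" by (simp add: algebra_simps)
  also have "\<dots> \<le> m * (\<rho> * (1 / 2 + \<delta>) - (1 / 2 - \<delta>))"
  proof (intro mult_left_mono)
    have "v * v \<le> 1 * 1" using v by (intro mult_mono) auto
    then have "4 * \<delta>\<^sup>2 * v + 8 * \<delta>\<^sup>2 * (v * v) \<le> 4 * \<delta>\<^sup>2 * 1 + 8 * \<delta>\<^sup>2 * 1"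
      using v by (intro add_mono mult_left_mono) auto
    also have "\<dots> \<le> 40 * \<delta>\<^sup>2 * \<rho>" 
      using mult_left_mono[OF \<rho>1, of "\<delta>\<^sup>2"] zero_le_power2[of \<delta>] by linarith
    finally show "2 * \<delta> * (1 + v) * \<rho> - 40 * \<delta>\<^sup>2 * \<rho> \<le> \<rho> * (1 / 2 + \<delta>) - (1 / 2 - \<delta>)"
      unfolding \<rho>' by (simp add: algebra_simps power2_eq_square)
  qed (use m in simp)
  finally show "m * ((1 / 2 - \<delta>) - \<rho> * (1 / 2 + \<delta>)) \<le> - (l * \<rho>)"
    by (simp add: algebra_simps)
qed

text \<open>The term \<open>\<gamma> * \<eta> z\<close> penalises an excess of mass on the small part; its fast relaxation pays for
  the interaction between two merging pieces of mass.\<close>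

definition power_potential :: "nat \<Rightarrow> nat \<Rightarrow> real \<Rightarrow> real \<Rightarrow> real \<Rightarrow> (nat \<Rightarrow> real) \<Rightarrow> real" where
  "power_potential m k p \<rho> \<gamma> \<eta> =
     (\<Sum>z\<in>{0..<m + k}. if z < m then \<eta> z powr p + \<gamma> * \<eta> z else \<rho> * \<eta> z powr p)"

text \<open>The interaction in \<open>merge\<close> is a product, so its double sum factorises into
  \<open>(m + n * SA) * (k + n * SB)\<close> with \<open>SA\<close>, \<open>SB\<close> the masses of
  the parts. For \<open>SA\<close> of order 1 this can reach order \<open>n * n\<close>, where only
  \<open>n * m\<close> is allowed; the penalty contributes
  \<open>10 * \<beta> * n * (m - n * SA)\<close> and absorbs the excess.\<close>

lemma power_potential_drift:
  fixes m k :: nat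
  defines "n \<equiv> real m + real k"
  assumes m: "1 \<le> m" "m \<le> k" and \<delta>: "\<bar>\<delta>\<bar> \<le> 1 / 8"
    and \<rho>: "\<rho> = 1 + 4 * \<delta> * (real k - real m) / n"
    and l: "l \<le> 4 * \<delta> * real m * real k / n - 40 * real m * \<delta>\<^sup>2" "4 * l \<le> n"
    and \<beta>: "0 \<le> \<beta>" and \<gamma>: "\<gamma> = 20 * \<beta> * n"
    and merge: "\<And>a b. 0 \<le> a \<Longrightarrow> 0 \<le> b \<Longrightarrow>
      ((a + b) / 2) powr p \<le> (1 / 2 - \<delta>) * (a powr p + b powr p) + \<beta> * ((1 + n * a) * (1 + n * b))"
    and \<eta>: "\<eta> \<in> prob_mass_functions {0..<m + k}"
  shows "(\<Sum>e\<in>complete_bipartite_edges m k.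
      power_potential m k p \<rho> \<gamma> (edge_average e \<eta>) - power_potential m k p \<rho> \<gamma> \<eta>)
    \<le> 15 * \<beta> * n * real m - l * power_potential m k p \<rho> \<gamma> \<eta>"
proof -
  let ?A = "{0..<m}" and ?B = "{m..<m + k}"
  define FA where "FA = (\<Sum>x\<in>?A. \<eta> x powr p)"
  define FB where "FB = (\<Sum>y\<in>?B. \<eta> y powr p)"
  define SA where "SA = (\<Sum>x\<in>?A. \<eta> x)"
  define SB where "SB = (\<Sum>y\<in>?B. \<eta> y)"
  \<comment> \<open>The net coefficients of the two old powers when an edge rings:
    \<open>(1 + \<rho>) * (1 / 2 - \<delta>)\<close> from the two new values, minus the old weight 1
    or \<open>\<rho>\<close>.\<close>
  define ca where "ca = \<rho> * (1 / 2 - \<delta>) - (1 / 2 + \<delta>)"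
  define cb where "cb = (1 / 2 - \<delta>) - \<rho> * (1 / 2 + \<delta>)"
  have w: "1 / 2 \<le> \<rho>" "\<rho> \<le> 3 / 2" "real k * ca \<le> - l" "real m * cb \<le> - (l * \<rho>)"
    unfolding ca_def cb_def
    using bipartite_weights[of "real m" "real k" \<delta> \<rho> l] m \<delta> \<rho> l unfolding n_def by auto
  have n: "0 < n" "real m \<le> n" "real k \<le> n" using m by (simp_all add: n_def)
  have \<eta>0: "0 \<le> \<eta> x" for x using \<eta> by (auto simp: prob_mass_functions_def)
  have F0: "0 \<le> FA" "0 \<le> FB" "0 \<le> SA" "0 \<le> SB"
    using \<eta>0 by (auto simp: FA_def FB_def SA_def SB_def intro!: sum_nonneg)
  have S1: "SA + SB = 1"
    using \<eta> by (simp add: SA_def SB_def prob_mass_functions_def sum_bipartite_parts)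
  have H: "power_potential m k p \<rho> \<gamma> \<eta> = FA + \<gamma> * SA + \<rho> * FB"
    unfolding power_potential_def sum_bipartite_parts FA_def FB_def SA_def sum_distrib_left
      sum.distrib[symmetric]
    by (intro arg_cong2[where f = "(+)"] sum.cong) auto
  let ?\<phi> = "\<lambda>z u. if z < m then u powr p + \<gamma> * u else \<rho> * u powr p"
  have "(\<Sum>e\<in>complete_bipartite_edges m k.
      power_potential m k p \<rho> \<gamma> (edge_average e \<eta>) - power_potential m k p \<rho> \<gamma> \<eta>) =
    (\<Sum>x\<in>?A. \<Sum>y\<in>?B. ?\<phi> x ((\<eta> x + \<eta> y) / 2) + ?\<phi> y ((\<eta> x + \<eta> y) / 2) - ?\<phi> x (\<eta> x) - ?\<phi> y (\<eta> y))"
    unfolding power_potential_def by (rule bipartite_drift_eq)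
  also have "\<dots> \<le> (\<Sum>x\<in>?A. \<Sum>y\<in>?B. ca * \<eta> x powr p + cb * \<eta> y powr p
      + 5 / 2 * \<beta> * ((1 + n * \<eta> x) * (1 + n * \<eta> y)) + \<gamma> / 2 * (\<eta> y - \<eta> x))"
  proof (intro sum_mono)
    fix x y assume xy: "x \<in> ?A" "y \<in> ?B"
    let ?a = "\<eta> x" and ?b = "\<eta> y"
    let ?P = "\<beta> * ((1 + n * ?a) * (1 + n * ?b))"
    have P0: "0 \<le> ?P" using \<beta> \<eta>0 n by simp
    have "(1 + \<rho>) * ((?a + ?b) / 2) powr p \<le> (1 + \<rho>) * ((1 / 2 - \<delta>) * (?a powr p + ?b powr p) + ?P)"
      using w \<eta>0 by (intro mult_left_mono merge) auto
    also have "\<dots> \<le> (1 + \<rho>) * ((1 / 2 - \<delta>) * (?a powr p + ?b powr p)) + 5 / 2 * ?P"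
      using mult_right_mono[of "1 + \<rho>" "5 / 2" ?P] w P0 by (simp add: distrib_left)
    finally have "(1 + \<rho>) * ((?a + ?b) / 2) powr p \<le>
        (1 + \<rho>) * ((1 / 2 - \<delta>) * (?a powr p + ?b powr p)) + 5 / 2 * ?P" .
    moreover have "?\<phi> x ((?a + ?b) / 2) + ?\<phi> y ((?a + ?b) / 2) - ?\<phi> x ?a - ?\<phi> y ?b =
        (1 + \<rho>) * ((?a + ?b) / 2) powr p - ?a powr p - \<rho> * ?b powr p + \<gamma> / 2 * (?b - ?a)"
      using xy by (simp add: algebra_simps)
    moreover have "(1 + \<rho>) * ((1 / 2 - \<delta>) * (?a powr p + ?b powr p)) - ?a powr p - \<rho> * ?b powr p =
        ca * ?a powr p + cb * ?b powr p"
      by (simp add: ca_def cb_def field_simps)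
    ultimately show "?\<phi> x ((?a + ?b) / 2) + ?\<phi> y ((?a + ?b) / 2) - ?\<phi> x ?a - ?\<phi> y ?b \<le>
        ca * ?a powr p + cb * ?b powr p + 5 / 2 * \<beta> * ((1 + n * ?a) * (1 + n * ?b)) + \<gamma> / 2 * (?b - ?a)"
      by simp
  qed
  also have "\<dots> = real k * ca * FA + real m * cb * FB
      + 5 / 2 * \<beta> * ((real m + n * SA) * (real k + n * SB)) + \<gamma> / 2 * (real m * SB - real k * SA)"
  proof -
    have "(\<Sum>x\<in>?A. 1 + n * \<eta> x) = real m + n * SA" "(\<Sum>y\<in>?B. 1 + n * \<eta> y) = real k + n * SB"
      by (simp_all add: sum.distrib SA_def SB_def sum_distrib_left)
    then have prod: "(\<Sum>x\<in>?A. \<Sum>y\<in>?B. (1 + n * \<eta> x) * (1 + n * \<eta> y)) = (real m + n * SA) * (real k + n * SB)"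
      by (metis sum_product)
    have "(\<Sum>x\<in>?A. \<Sum>y\<in>?B. ca * \<eta> x powr p) = real k * ca * FA"
      "(\<Sum>x\<in>?A. \<Sum>y\<in>?B. cb * \<eta> y powr p) = real m * cb * FB"
      by (simp_all add: FA_def FB_def sum_distrib_left mult_ac)
    moreover have "(\<Sum>x\<in>?A. \<Sum>y\<in>?B. 5 / 2 * \<beta> * ((1 + n * \<eta> x) * (1 + n * \<eta> y))) =
        5 / 2 * \<beta> * ((real m + n * SA) * (real k + n * SB))"
      unfolding prod[symmetric] by (simp only: sum_distrib_left)
    moreover have "(\<Sum>x\<in>?A. \<Sum>y\<in>?B. \<gamma> / 2 * (\<eta> y - \<eta> x)) = \<gamma> / 2 * (real m * SB - real k * SA)"
      unfolding sum_distrib_left[symmetric] sum_subtractf by (simp add: SA_def SB_def sum_distrib_left)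
    ultimately show ?thesis by (simp only: sum.distrib)
  qed
  also have "\<dots> \<le> - l * FA - l * \<rho> * FB + 5 * \<beta> * n * (real m + n * SA) + 10 * \<beta> * n * (real m - n * SA)"
  proof (intro add_mono)
    show "real k * ca * FA + real m * cb * FB \<le> - l * FA - l * \<rho> * FB"
      using mult_right_mono[OF w(3) F0(1)] mult_right_mono[OF w(4) F0(2)] by simp
    have "SB \<le> 1" using S1 F0 by simp
    then have "n * SB \<le> n" using n by (simp add: mult_left_le)
    then have "real k + n * SB \<le> 2 * n" using n by linarith
    then have "5 / 2 * \<beta> * ((real m + n * SA) * (real k + n * SB)) \<le> 5 / 2 * \<beta> * ((real m + n * SA) * (2 * n))"
      using \<beta> F0 n by (intro mult_left_mono) auto
    then show "5 / 2 * \<beta> * ((real m + n * SA) * (real k + n * SB)) \<le> 5 * \<beta> * n * (real m + n * SA)"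
      by (simp add: algebra_simps)
    have "real m * SB - real k * SA = real m - n * SA"
    proof -
      have "SB = 1 - SA" using S1 by simp
      then show ?thesis unfolding n_def by (simp only:) (simp add: algebra_simps)
    qed
    then show "\<gamma> / 2 * (real m * SB - real k * SA) \<le> 10 * \<beta> * n * (real m - n * SA)"
      by (simp add: \<gamma>)
  qed
  \<comment> \<open>Of the 10 units of relaxation, 5 pay for the interaction. The other 5 cover the
    decay \<open>l * \<gamma> * SA\<close> demanded of the penalty itself, since
    \<open>\<gamma> = 20 * \<beta> * n\<close> and \<open>4 * l \<le> n\<close>.\<close>
  also have "\<dots> = 15 * \<beta> * n * real m - l * (FA + \<gamma> * SA + \<rho> * FB) - 5 * \<beta> * n * SA * (n - 4 * l)"
    by (simp add: \<gamma> algebra_simps)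
  also have "\<dots> \<le> 15 * \<beta> * n * real m - l * (FA + \<gamma> * SA + \<rho> * FB)"
    using \<beta> n F0 l(2) by simp
  finally show ?thesis unfolding H .
qed

section \<open>Lower bound\<close>

lemma L1_norm_uniform:
  fixes n :: nat
  assumes "0 < n"
  shows "L1_norm {0..<n} (uniform_mass {0..<n}) (\<lambda>x. \<eta> x / uniform_mass {0..<n} x - 1) =
    (\<Sum>x\<in>{0..<n}. \<bar>\<eta> x - 1 / n\<bar>)"
  unfolding L1_norm_def
proof (intro sum.cong refl)
  fix x
  have "real n * \<bar>\<eta> x - 1 / n\<bar> = \<bar>real n * (\<eta> x - 1 / n)\<bar>" by (simp add: abs_mult)
  also have "real n * (\<eta> x - 1 / n) = \<eta> x * real n - 1" using assms by (simp add: algebra_simps)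
  finally show "uniform_mass {0..<n} x * \<bar>\<eta> x / uniform_mass {0..<n} x - 1\<bar> = \<bar>\<eta> x - 1 / n\<bar>"
    using assms by (simp add: uniform_mass_def field_simps)
qed

lemma two_minus_sum_abs_eq:
  fixes n :: nat
  assumes "\<eta> \<in> prob_mass_functions {0..<n}" "0 < n"
  shows "2 - (\<Sum>x\<in>{0..<n}. \<bar>\<eta> x - 1 / n\<bar>) = 2 * (\<Sum>x\<in>{0..<n}. min (\<eta> x) (1 / n))"
proof -
  have "(\<Sum>x\<in>{0..<n}. \<bar>\<eta> x - 1 / n\<bar>) = (\<Sum>x\<in>{0..<n}. \<eta> x + 1 / n - 2 * min (\<eta> x) (1 / n))"
    by (intro sum.cong) (auto simp: min_def)
  also have "\<dots> = (\<Sum>x\<in>{0..<n}. \<eta> x) + real n * (1 / n) - 2 * (\<Sum>x\<in>{0..<n}. min (\<eta> x) (1 / n))"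
    by (simp add: sum.distrib sum_subtractf sum_distrib_left)
  also have "\<dots> = 2 - 2 * (\<Sum>x\<in>{0..<n}. min (\<eta> x) (1 / n))"
    using assms by (simp add: prob_mass_functions_def)
  finally show ?thesis by simp
qed

lemma powr_add_le:
  fixes a b p :: real
  assumes "0 \<le> a" "0 \<le> b" "p \<le> 1"
  shows "(a + b) powr p \<le> a powr p + b powr p"
proof (cases "a + b = 0")
  case False
  define s where "s = a + b"
  have s: "0 < s" "a \<le> s" "b \<le> s" using False assms by (auto simp: s_def)
  have le: "x / s \<le> (x / s) powr p" if "0 \<le> x" "x \<le> s" for x
    using powr_mono'[of p 1 "x / s"] assms(3) that s by simp
  have "1 = a / s + b / s" using s(1) by (simp add: s_def add_divide_distrib[symmetric])
  also have "\<dots> \<le> (a / s) powr p + (b / s) powr p" using le s assms by (intro add_mono) auto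
  finally have "s powr p * 1 \<le> s powr p * ((a / s) powr p + (b / s) powr p)"
    by (intro mult_left_mono) auto
  also have "\<dots> = a powr p + b powr p"
    using s assms by (simp add: distrib_left powr_divide)
  finally show ?thesis by (simp add: s_def)
qed (use assms in auto)

text \<open>\<open>min u v\<close> is the product of its own powers with exponents
  \<open>1 - \<theta>\<close> and \<open>\<theta>\<close>. With \<open>v = 1 / n\<close> this
  converts overlap with the uniform distribution into a power sum.\<close>

lemma min_le_powr_mult:
  fixes u v \<theta> :: real
  assumes "0 \<le> u" "0 < v" "0 \<le> \<theta>" "\<theta> \<le> 1"
  shows "min u v \<le> u powr (1 - \<theta>) * v powr \<theta>"
proof (cases "u = 0")
  case False
  define w where "w = min u v"
  have w: "0 < w" "w \<le> u" "w \<le> v" using assms False by (auto simp: w_def)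
  then have "w = w powr (1 - \<theta>) * w powr \<theta>" by (simp add: powr_add[symmetric])
  also have "\<dots> \<le> u powr (1 - \<theta>) * v powr \<theta>"
    using w assms by (intro mult_mono powr_mono2) auto
  finally show ?thesis by (simp add: w_def)
qed (use assms in auto)

lemma sum_abs_diff_measurable:
  fixes n :: nat
  assumes "averaging_process {0..<n} E \<xi> M \<eta>" "0 \<le> t"
  shows "(\<lambda>\<omega>. \<Sum>x\<in>{0..<n}. \<bar>\<eta> t \<omega> x - 1 / n\<bar>) \<in> borel_measurable M"
proof (rule borel_measurable_sum)
  fix x assume "x \<in> {0..<n}"
  then have [measurable]: "(\<lambda>\<omega>. \<eta> t \<omega> x) \<in> borel_measurable M"
    using assms by (auto simp: averaging_process_def)
  show "(\<lambda>\<omega>. \<bar>\<eta> t \<omega> x - 1 / n\<bar>) \<in> borel_measurable M" by measurable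
qed

lemma sum_abs_diff_le_2:
  fixes n :: nat
  assumes "\<eta> \<in> prob_mass_functions {0..<n}" "0 < n"
  shows "(\<Sum>x\<in>{0..<n}. \<bar>\<eta> x - 1 / n\<bar>) \<le> 2"
proof -
  have "0 \<le> 2 * (\<Sum>x\<in>{0..<n}. min (\<eta> x) (1 / n))"
    using assms by (auto simp: prob_mass_functions_def intro!: sum_nonneg)
  then show ?thesis using two_minus_sum_abs_eq[OF assms] by simp
qed

lemma
  fixes n :: nat
  assumes proc: "averaging_process {0..<n} E \<xi> M \<eta>" and n: "0 < n" and t: "0 \<le> t"
  shows integrable_sum_abs_diff: "integrable M (\<lambda>\<omega>. \<Sum>x\<in>{0..<n}. \<bar>\<eta> t \<omega> x - 1 / n\<bar>)"
    and averaging_process_L1_le_2: "(\<integral>\<omega>. (\<Sum>x\<in>{0..<n}. \<bar>\<eta> t \<omega> x - 1 / n\<bar>) \<partial>M) \<le> 2"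
proof -
  interpret prob_space M using proc by (simp add: averaging_process_def)
  have le: "(\<Sum>x\<in>{0..<n}. \<bar>\<eta> t \<omega> x - 1 / n\<bar>) \<le> 2" if "\<omega> \<in> space M" for \<omega>
    using proc t that by (intro sum_abs_diff_le_2 n) (auto simp: averaging_process_def)
  then show int: "integrable M (\<lambda>\<omega>. \<Sum>x\<in>{0..<n}. \<bar>\<eta> t \<omega> x - 1 / n\<bar>)"
    by (intro integrable_const_bound[where B = 2] sum_abs_diff_measurable[OF proc t] AE_I2)
       (simp add: sum_nonneg)
  have "(\<integral>\<omega>. (\<Sum>x\<in>{0..<n}. \<bar>\<eta> t \<omega> x - 1 / n\<bar>) \<partial>M) \<le> (\<integral>\<omega>. 2 \<partial>M)"
    using le int by (intro integral_mono) auto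
  then show "(\<integral>\<omega>. (\<Sum>x\<in>{0..<n}. \<bar>\<eta> t \<omega> x - 1 / n\<bar>) \<partial>M) \<le> 2" by (simp add: prob_space)
qed

lemma two_powr_le:
  fixes x :: real assumes "0 \<le> x" "x \<le> 1"
  shows "2 powr x \<le> 1 + x * ln 2 + x\<^sup>2"
proof -
  have ln2: "0 \<le> ln (2::real)" "ln (2::real) \<le> 1" using ln_2_less_1 by auto
  have "x * ln 2 \<le> 1 * 1" using assms ln2 by (intro mult_mono) auto
  then have "exp (x * ln 2) \<le> 1 + x * ln 2 + (x * ln 2)\<^sup>2" using assms ln2 by (intro exp_bound) auto
  also have "(x * ln 2)\<^sup>2 \<le> x\<^sup>2" using assms ln2 by (intro power_mono) (auto simp: mult_left_le)
  finally show ?thesis by (simp add: powr_def)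
qed

lemma ln_2_ge_half: "1 / 2 \<le> ln (2::real)"
  using ln2_ge_two_thirds by simp

lemma cutoff_time_eq:
  assumes "0 < m" "0 < k"
  shows "cutoff_time (m + k) m a =
    (real m + real k) / (2 * real k) * (ln (real (m + k)) / (ln 2 * real m)) + a * (sqrt (ln (real (m + k))) / real m)"
  using assms by (simp add: cutoff_time_def log_def)

text \<open>From a point mass the potential starts at 1 and grows with exponent at most
  \<open>- (l * T) \<le> \<theta> * L - a / 2 + 84\<close>. The factor
  \<open>N powr (- \<theta>) = exp (- (\<theta> * L))\<close> in front of the power sum cancels the
  leading part.\<close>

lemma averaging_process_L1_lower:
  fixes m k :: nat
  defines "n \<equiv> m + k" and "L \<equiv> ln (real (m + k))"
  assumes m: "1 \<le> m" "m \<le> k" and L: "64 \<le> L"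
    and proc: "averaging_process {0..<n} (complete_bipartite_edges m k) \<xi> M \<eta>"
    and \<xi>: "\<xi> = (\<lambda>x. if x = 0 then 1 else 0)"
    and a: "0 \<le> a" and T: "T = cutoff_time n m (- a)" "0 < T"
  shows "2 - 4 * exp (84 - a / 2) \<le> (\<integral>\<omega>. (\<Sum>x\<in>{0..<n}. \<bar>\<eta> T \<omega> x - 1 / n\<bar>) \<partial>M)"
proof -
  interpret prob_space M using proc by (simp add: averaging_process_def)
  let ?E = "complete_bipartite_edges m k"
  define N where "N = real m + real k"
  have N: "real n = N" "0 < N" "real m \<le> N" "real k \<le> N" "N \<le> 2 * real k" and n: "0 < n"
    and k: "1 \<le> k"
    using m by (simp_all add: N_def n_def)
  define \<theta> where "\<theta> = 1 / sqrt L"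
  have "sqrt 64 \<le> sqrt L" using L by (intro real_sqrt_le_mono)
  then have sL: "8 \<le> sqrt L" by simp
  then have \<theta>: "0 < \<theta>" "\<theta> \<le> 1 / 8" "\<theta> * sqrt L = 1"
    using L by (auto simp: \<theta>_def divide_simps)
  have \<theta>L: "\<theta> * L = sqrt L" using L by (simp add: \<theta>_def real_div_sqrt)
  have \<theta>2L: "\<theta>\<^sup>2 * L = 1" using L by (simp add: \<theta>_def power_divide)
  define \<delta> where "\<delta> = 1 / 2 - 2 powr \<theta> / 2"
  define p where "p = 1 - \<theta>"
  define \<rho> where "\<rho> = 1 + 4 * \<delta> * (real k - real m) / (real m + real k)"
  \<comment> \<open>Here \<open>\<delta> \<le> 0\<close>, so \<open>l\<close> is negative and
    describes growth. The 42 is the 40 of \<open>bipartite_weights\<close> plus 2 from the quadratic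
    remainder in \<open>two_powr_le\<close>.\<close>
  define l where "l = - (2 * ln 2 * \<theta> * real m * real k / N + 42 * real m * \<theta>\<^sup>2)"
  have \<theta>sq: "0 \<le> \<theta>\<^sup>2" "\<theta>\<^sup>2 \<le> \<theta> / 8"
    using \<theta> mult_left_mono[of \<theta> "1/8" \<theta>] by (auto simp: power2_eq_square)
  have \<delta>0: "- (\<theta> * ln 2 + \<theta>\<^sup>2) \<le> 2 * \<delta>" "\<delta> \<le> 0"
    using two_powr_le[of \<theta>] ge_one_powr_ge_zero[of 2 \<theta>] \<theta> by (auto simp: \<delta>_def)
  have "\<theta> * ln 2 \<le> \<theta>" using \<theta> ln_2_less_1 by (simp add: mult_left_le)
  then have \<delta>\<theta>: "\<bar>\<delta>\<bar> \<le> \<theta>" using \<delta>0 \<theta>sq by auto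
  have \<delta>8: "\<bar>\<delta>\<bar> \<le> 1 / 8" using \<delta>\<theta> \<theta> by simp
  have d2: "\<delta>\<^sup>2 \<le> \<theta>\<^sup>2" using \<delta>\<theta> \<theta> abs_le_square_iff[of \<delta> \<theta>] by simp
  have l1: "l \<le> 4 * \<delta> * real m * real k / (real m + real k) - 40 * real m * \<delta>\<^sup>2"
  proof -
    have q: "0 \<le> real m * real k / N" "real m * real k / N \<le> real m"
      using N by (auto simp: divide_simps mult_left_mono)
    have "- (2 * \<theta> * ln 2 + 2 * \<theta>\<^sup>2) * (real m * real k / N) \<le> 4 * \<delta> * (real m * real k / N)"
      using \<delta>0 q(1) by (intro mult_right_mono) auto
    moreover have "2 * \<theta>\<^sup>2 * (real m * real k / N) \<le> 2 * \<theta>\<^sup>2 * real m"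
      using q(2) by (intro mult_left_mono) auto
    moreover have "40 * real m * \<delta>\<^sup>2 \<le> 40 * real m * \<theta>\<^sup>2" using d2 by (intro mult_left_mono) auto
    ultimately show ?thesis unfolding l_def N_def[symmetric] by (simp add: algebra_simps)
  qed
  have l0: "l \<le> 0" using \<theta> N unfolding l_def neg_le_0_iff_le by (intro add_nonneg_nonneg) auto
  have w: "1 / 2 \<le> \<rho>" "\<rho> \<le> 3 / 2"
    using bipartite_weights(1,2)[of "real m" "real k" \<delta> \<rho> l] m \<delta>8 l1 by (auto simp: \<rho>_def)
  define G where "G = power_potential m k p \<rho> 0"
  have q: "1 / 2 - \<delta> = 2 powr (- p)" by (simp add: \<delta>_def p_def powr_diff)
  have merge: "((a + b) / 2) powr p \<le> (1 / 2 - \<delta>) * (a powr p + b powr p) + 0 * ((1 + N * a) * (1 + N * b))"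
    if "0 \<le> a" "0 \<le> b" for a b :: real
  proof -
    have "((a + b) / 2) powr p = 2 powr (- p) * (a + b) powr p"
      using that by (simp add: powr_divide powr_minus_divide)
    also have "\<dots> \<le> 2 powr (- p) * (a powr p + b powr p)"
      using powr_add_le[OF that, of p] \<theta> by (intro mult_left_mono) (auto simp: p_def)
    finally show ?thesis by (simp add: q)
  qed
  have G0: "0 \<le> G \<zeta>" for \<zeta>
    using w unfolding G_def power_potential_def by (intro sum_nonneg) auto
  have drift: "(\<Sum>e\<in>?E. G (edge_average e \<zeta>) - G \<zeta>) \<le> l * (0 - G \<zeta>)"
    if "\<zeta> \<in> prob_mass_functions {0..<n}" for \<zeta>
  proof -
    have "(\<Sum>e\<in>?E. G (edge_average e \<zeta>) - G \<zeta>) \<le> 15 * 0 * N * real m - l * G \<zeta>"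
      unfolding G_def N_def
      by (rule power_potential_drift[where \<beta> = 0 and \<delta> = \<delta> and p = p, OF m \<delta>8 _ l1])
         (use that l0 merge in \<open>auto simp: \<rho>_def n_def N_def\<close>)
    then show ?thesis by simp
  qed
  have EV: "finite {0..<n}" "finite ?E" "?E \<subseteq> edges_on {0..<n}"
    using finite_complete_bipartite_edges complete_bipartite_edges_subset by (auto simp: n_def)
  have Ene: "?E \<noteq> {}"
    using card_complete_bipartite_edges[of m k] m by (metis card.empty k mult_eq_0_iff not_one_le_zero)
  have steps: "euler_steps ?E h j G \<zeta> \<le> exp (- (l * (\<Sum>i<j. h i))) * G \<zeta>"
    if "\<zeta> \<in> prob_mass_functions {0..<n}" "\<And>i. 0 \<le> h i" for \<zeta> h j
    using euler_steps_drift[OF EV that(2) G0 drift _ _ that(1)] l0 by simp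
  define F where "F = (\<lambda>\<zeta> :: nat \<Rightarrow> real. 2 - (\<Sum>x\<in>{0..<n}. \<bar>\<zeta> x - 1 / n\<bar>))"
  \<comment> \<open>One factor 2 comes from \<open>two_minus_sum_abs_eq\<close>, the other from
    weights that are at least \<open>1 / 2\<close>.\<close>
  define C where "C = 4 * N powr (- \<theta>)"
  have F_eq: "F \<zeta> = 2 * (\<Sum>x\<in>{0..<n}. min (\<zeta> x) (1 / n))" if "\<zeta> \<in> prob_mass_functions {0..<n}" for \<zeta>
    unfolding F_def by (rule two_minus_sum_abs_eq[OF that n])
  have F0: "0 \<le> F \<zeta>" if "\<zeta> \<in> prob_mass_functions {0..<n}" for \<zeta>
    using sum_abs_diff_le_2[OF that n] by (simp add: F_def)
  have F2: "F \<zeta> \<le> 2" for \<zeta> unfolding F_def by (simp add: sum_nonneg)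
  have FG: "F \<zeta> \<le> C * G \<zeta> + 0" if z: "\<zeta> \<in> prob_mass_functions {0..<n}" for \<zeta>
  proof -
    have "F \<zeta> \<le> 2 * (\<Sum>x\<in>{0..<n}. \<zeta> x powr p * N powr (- \<theta>))"
      unfolding F_eq[OF z]
    proof (intro mult_left_mono sum_mono)
      fix x
      have "min (\<zeta> x) (1 / n) \<le> \<zeta> x powr (1 - \<theta>) * (1 / n) powr \<theta>"
        using z \<theta> n by (intro min_le_powr_mult) (auto simp: prob_mass_functions_def)
      also have "(1 / n) powr \<theta> = N powr (- \<theta>)" using N by (simp add: powr_divide powr_minus_divide)
      finally show "min (\<zeta> x) (1 / n) \<le> \<zeta> x powr p * N powr (- \<theta>)" by (simp add: p_def)
    qed simp
    also have "\<dots> = 2 * N powr (- \<theta>) * (\<Sum>x\<in>{0..<n}. \<zeta> x powr p)"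
      by (simp add: sum_distrib_left mult_ac)
    also have "\<dots> \<le> 2 * N powr (- \<theta>) * (2 * G \<zeta>)"
    proof (rule mult_left_mono)
      have "u powr p \<le> 2 * (\<rho> * u powr p)" for u
        using mult_right_mono[OF w(1), of "u powr p"] by simp
      then show "(\<Sum>x\<in>{0..<n}. \<zeta> x powr p) \<le> 2 * G \<zeta>"
        unfolding G_def power_potential_def n_def sum_distrib_left by (intro sum_mono) auto
    qed simp
    finally show ?thesis by (simp add: C_def)
  qed
  \<comment> \<open>A single estimate serves the whole time, so the two stages are just its
    halves.\<close>
  have "(\<integral>\<omega>. F (\<eta> (T / 2 + T / 2) \<omega>) \<partial>M) \<le> C * exp (- (l * T))"
  proof (rule averaging_process_expectation_le[OF proc EV(2) Ene EV(3) F0 F2])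
    show "(\<lambda>\<omega>. F (\<eta> (T / 2 + T / 2) \<omega>)) \<in> borel_measurable M"
      using sum_abs_diff_measurable[OF proc, of T] T unfolding F_def by simp
    fix h h' :: "nat \<Rightarrow> real" and i j :: nat
    assume h: "\<And>i. 0 \<le> h i" "\<And>i. 0 \<le> h' i" and sums: "sum h {..<i} = T / 2" "sum h' {..<j} = T / 2"
    have \<xi>V: "\<xi> \<in> prob_mass_functions {0..<n}" using n by (auto simp: \<xi> prob_mass_functions_def)
    have "euler_steps ?E h' j F \<zeta> \<le> C * exp (- (l * (T / 2))) * G \<zeta> + 0"
      if "\<zeta> \<in> prob_mass_functions {0..<n}" for \<zeta>
    proof -
      have "euler_steps ?E h' j F \<zeta> \<le> euler_steps ?E h' j (\<lambda>\<zeta>. C * G \<zeta> + 0) \<zeta>"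
        by (rule euler_steps_mono[OF EV(1,3) h(2) that FG])
      also have "\<dots> \<le> C * euler_steps ?E h' j G \<zeta> + 0"
        by (rule euler_steps_affine_le[OF EV(2) h(2)]) simp
      also have "\<dots> \<le> C * (exp (- (l * (T / 2))) * G \<zeta>) + 0"
        using steps[OF that h(2)] unfolding sums(2)[symmetric]
        by (intro add_mono mult_left_mono) (auto simp: C_def)
      finally show ?thesis by simp
    qed
    then have "euler_steps ?E h i (euler_steps ?E h' j F) \<xi> \<le>
        euler_steps ?E h i (\<lambda>\<zeta>. C * exp (- (l * (T / 2))) * G \<zeta> + 0) \<xi>"
      by (rule euler_steps_mono[OF EV(1,3) h(1) \<xi>V])
    also have "\<dots> \<le> C * exp (- (l * (T / 2))) * euler_steps ?E h i G \<xi> + 0"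
      by (rule euler_steps_affine_le[OF EV(2) h(1)]) simp
    also have "\<dots> \<le> C * exp (- (l * (T / 2))) * (exp (- (l * (T / 2))) * G \<xi>) + 0"
      using steps[OF \<xi>V h(1)] sums(1)[symmetric]
      by (intro add_mono mult_left_mono) (auto simp: C_def)
    also have "\<dots> = C * exp (- (l * T)) * G \<xi>"
      by (simp add: exp_add[symmetric])
    also have "G \<xi> = 1"
    proof -
      have "G \<xi> = (\<Sum>z\<in>{0..<m + k}. if z = 0 then 1 else 0)"
        unfolding G_def power_potential_def \<xi> using m by (intro sum.cong) auto
      then show ?thesis using m by simp
    qed
    finally show "euler_steps ?E h i (euler_steps ?E h' j F) \<xi> \<le> C * exp (- (l * T))" by simp
  qed (use T in auto)
  also have "C * exp (- (l * T)) \<le> 4 * exp (84 - a / 2)"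
  proof -
    have T_eq: "T = N / (2 * real k) * (L / (ln 2 * real m)) - a * (sqrt L / real m)"
      unfolding T(1) n_def using cutoff_time_eq[of m k "- a"] m by (simp add: N_def L_def)
    \<comment> \<open>Since \<open>T \<le> 2 * L / m\<close>, the second-order growth costs at most
      \<open>42 * 2 = 84\<close>.\<close>
    have "42 * real m * \<theta>\<^sup>2 * T \<le> 42 * real m * \<theta>\<^sup>2 * (1 * (L / (1 / 2 * real m)))"
    proof (intro mult_left_mono)
      have "N / (2 * real k) * (L / (ln 2 * real m)) \<le> 1 * (L / (1 / 2 * real m))"
        using N k m L ln_2_ge_half by (intro mult_mono divide_left_mono mult_right_mono) auto
      moreover have "0 \<le> a * (sqrt L / real m)" using a L by simp
      ultimately show "T \<le> 1 * (L / (1 / 2 * real m))" unfolding T_eq by linarith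
    qed simp
    also have "\<dots> = 84 * (\<theta>\<^sup>2 * L)" using m by (simp add: field_simps)
    finally have e1: "42 * real m * \<theta>\<^sup>2 * T \<le> 84" unfolding \<theta>2L by simp
    have "2 * ln 2 * \<theta> * real m * real k / N * T =
        \<theta> * L - 2 * ln 2 * (real k / N) * a * (\<theta> * sqrt L)"
      unfolding T_eq using N m k by (simp add: field_simps)
    also have "\<dots> \<le> \<theta> * L - a / 2"
    proof -
      have "1 / 2 \<le> real k / N" using N by (simp add: field_simps)
      then have "1 / 2 * (1 / 2) \<le> ln 2 * (real k / N)" using ln_2_ge_half by (intro mult_mono) auto
      then have "1 / 2 \<le> 2 * (ln 2 * (real k / N))" by linarith
      then have "1 / 2 * a \<le> 2 * (ln 2 * (real k / N)) * a" using a by (rule mult_right_mono)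
      moreover have "2 * ln 2 * (real k / N) * a * (\<theta> * sqrt L) = 2 * (ln 2 * (real k / N)) * a"
        unfolding \<theta>(3) by (simp only: mult_1_right mult.assoc)
      ultimately show ?thesis by linarith
    qed
    finally have "- (l * T) \<le> \<theta> * L - a / 2 + 84"
      using e1 by (simp add: l_def algebra_simps)
    moreover have "C = 4 * exp (- (\<theta> * L))"
      using N by (simp add: C_def powr_def L_def N_def)
    ultimately have "C * exp (- (l * T)) \<le> 4 * exp (- (\<theta> * L)) * exp (\<theta> * L - a / 2 + 84)" by simp
    also have "\<dots> = 4 * exp (84 - a / 2)" by (simp add: exp_add[symmetric])
    finally show ?thesis .
  qed
  finally have "(\<integral>\<omega>. F (\<eta> T \<omega>) \<partial>M) \<le> 4 * exp (84 - a / 2)" by simp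
  moreover have "integrable M (\<lambda>\<omega>. \<Sum>x\<in>{0..<n}. \<bar>\<eta> T \<omega> x - 1 / n\<bar>)"
    using integrable_sum_abs_diff[OF proc n] T by simp
  then have "(\<integral>\<omega>. F (\<eta> T \<omega>) \<partial>M) = 2 - (\<integral>\<omega>. (\<Sum>x\<in>{0..<n}. \<bar>\<eta> T \<omega> x - 1 / n\<bar>) \<partial>M)"
    unfolding F_def by (subst Bochner_Integration.integral_diff) (auto simp: prob_space)
  ultimately show ?thesis by simp
qed

section \<open>Upper bound\<close>

lemma sum_edge_average:
  assumes "finite V" "e \<in> edges_on V"
  shows "(\<Sum>z\<in>V. edge_average e v z) = (\<Sum>z\<in>V. v z)"
proof -
  obtain x y where "e = {x, y}" "x \<in> V" "y \<in> V" "x \<noteq> y"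
    using assms(2) by (auto simp: edges_on_def)
  with sum_edge_average_diff[of V x y "\<lambda>_ u. u" v] assms(1) show ?thesis by simp
qed

lemma sum_abs_edge_average_le:
  assumes "finite V" "e \<in> edges_on V"
  shows "(\<Sum>z\<in>V. \<bar>edge_average e w z\<bar>) \<le> (\<Sum>z\<in>V. \<bar>w z\<bar>)"
proof -
  obtain x y where "e = {x, y}" "x \<in> V" "y \<in> V" "x \<noteq> y"
    using assms(2) by (auto simp: edges_on_def)
  with sum_edge_average_diff[of V x y "\<lambda>_ u. \<bar>u\<bar>" w] assms(1) show ?thesis by simp
qed

text \<open>Averaging a pair lowers the sum of squares by half the squared difference. Summed over
  the edges, the cross terms give \<open>SA * SB\<close>, which is nonpositive since the total
  vanishes; what remains is half the degree of each vertex, at least \<open>m / 2\<close>.\<close>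

lemma bipartite_spectral_gap:
  fixes m k :: nat and v :: "nat \<Rightarrow> real"
  assumes "m \<le> k" and v: "(\<Sum>z\<in>{0..<m + k}. v z) = 0"
  shows "(\<Sum>e\<in>complete_bipartite_edges m k. \<Sum>z\<in>{0..<m + k}. (edge_average e v z)\<^sup>2)
    \<le> (real (m * k) - real m / 2) * (\<Sum>z\<in>{0..<m + k}. (v z)\<^sup>2)"
proof -
  let ?A = "{0..<m}" and ?B = "{m..<m + k}"
  define SA where "SA = (\<Sum>x\<in>?A. v x)"
  define SB where "SB = (\<Sum>y\<in>?B. v y)"
  define QA where "QA = (\<Sum>x\<in>?A. (v x)\<^sup>2)"
  define QB where "QB = (\<Sum>y\<in>?B. (v y)\<^sup>2)"
  have S: "SB = - SA" using v by (simp add: sum_bipartite_parts SA_def SB_def)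
  have QA0: "0 \<le> QA" by (simp add: QA_def sum_nonneg)
  have prod: "(\<Sum>x\<in>?A. \<Sum>y\<in>?B. v x * v y) = SA * SB"
    by (simp add: SA_def SB_def sum_product)
  have "(\<Sum>e\<in>complete_bipartite_edges m k.
      (\<Sum>z\<in>{0..<m + k}. (edge_average e v z)\<^sup>2) - (\<Sum>z\<in>{0..<m + k}. (v z)\<^sup>2)) =
    (\<Sum>x\<in>?A. \<Sum>y\<in>?B. ((v x + v y) / 2)\<^sup>2 + ((v x + v y) / 2)\<^sup>2 - (v x)\<^sup>2 - (v y)\<^sup>2)"
    by (rule bipartite_drift_eq)
  also have "\<dots> = (\<Sum>x\<in>?A. \<Sum>y\<in>?B. v x * v y - 1 / 2 * (v x)\<^sup>2 - 1 / 2 * (v y)\<^sup>2)"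
    by (intro sum.cong refl) (simp add: power2_eq_square field_simps)
  also have "\<dots> = SA * SB - real k / 2 * QA - real m / 2 * QB"
    unfolding sum_subtractf prod by (simp add: QA_def QB_def sum_distrib_left)
  also have "\<dots> \<le> - (real m / 2) * (QA + QB)"
  proof -
    have "real m * QA \<le> real k * QA" using assms(1) QA0 by (intro mult_right_mono) auto
    moreover have "SA * SB \<le> 0" by (simp add: S)
    ultimately show ?thesis by (simp add: field_simps)
  qed
  also have "QA + QB = (\<Sum>z\<in>{0..<m + k}. (v z)\<^sup>2)" by (simp add: QA_def QB_def sum_bipartite_parts)
  finally show ?thesis
    by (simp add: sum_subtractf card_complete_bipartite_edges algebra_simps)
qed

text \<open>The averaging acts linearly, so the deviation from equilibrium may be split into a mean-zero part
  controlled in \<open>L\<^sup>2\<close> by the spectral gap and a part whose \<open>L\<^sup>1\<close> norm does not increase.\<close>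

lemma euler_steps_L1_split:
  fixes m k :: nat
  defines "n \<equiv> m + k"
  assumes m: "1 \<le> m" "m \<le> k" and h: "\<And>i. 0 \<le> h i" and \<epsilon>: "0 < \<epsilon>"
    and \<eta>: "\<And>x. x \<in> {0..<n} \<Longrightarrow> \<eta> x - 1 / n = v x + w x" and v: "(\<Sum>x\<in>{0..<n}. v x) = 0"
  shows "euler_steps (complete_bipartite_edges m k) h j (\<lambda>\<zeta>. \<Sum>x\<in>{0..<n}. \<bar>\<zeta> x - 1 / n\<bar>) \<eta> \<le>
    \<epsilon> / 2 + (\<Sum>x\<in>{0..<n}. \<bar>w x\<bar>) +
    exp (- (real m / 2 * (\<Sum>i<j. h i))) * (real n / (2 * \<epsilon>) * (\<Sum>x\<in>{0..<n}. (v x)\<^sup>2))"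
  using h \<eta> v
proof (induction j arbitrary: h \<eta> v w)
  case 0
  have n: "0 < n" using m by (simp add: n_def)
  have "(\<Sum>x\<in>{0..<n}. \<bar>\<eta> x - 1 / n\<bar>) \<le>
      (\<Sum>x\<in>{0..<n}. \<epsilon> / (2 * real n) + \<bar>w x\<bar> + real n / (2 * \<epsilon>) * (v x)\<^sup>2)"
  proof (rule sum_mono)
    fix x assume x: "x \<in> {0..<n}"
    \<comment> \<open>Young's inequality rather than Cauchy-Schwarz: a bound linear in the sum of
      squares passes through the average over edges directly.\<close>
    have "0 \<le> (\<epsilon> - real n * \<bar>v x\<bar>)\<^sup>2" by simp
    then have "2 * \<epsilon> * real n * \<bar>v x\<bar> \<le> \<epsilon>\<^sup>2 + (real n)\<^sup>2 * (v x)\<^sup>2"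
      by (simp add: power2_diff power_mult_distrib algebra_simps)
    then have "\<bar>v x\<bar> \<le> \<epsilon> / (2 * real n) + real n / (2 * \<epsilon>) * (v x)\<^sup>2"
      using \<epsilon> n by (simp add: field_simps power2_eq_square)
    moreover have "\<bar>\<eta> x - 1 / n\<bar> \<le> \<bar>v x\<bar> + \<bar>w x\<bar>" unfolding 0(2)[OF x] by (rule abs_triangle_ineq)
    ultimately show "\<bar>\<eta> x - 1 / n\<bar> \<le> \<epsilon> / (2 * real n) + \<bar>w x\<bar> + real n / (2 * \<epsilon>) * (v x)\<^sup>2"
      by linarith
  qed
  also have "\<dots> = \<epsilon> / 2 + (\<Sum>x\<in>{0..<n}. \<bar>w x\<bar>) + real n / (2 * \<epsilon>) * (\<Sum>x\<in>{0..<n}. (v x)\<^sup>2)"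
    using n by (simp add: sum.distrib sum_distrib_left)
  finally show ?case by simp
next
  case (Suc j)
  let ?E = "complete_bipartite_edges m k"
  let ?F = "\<lambda>\<zeta> :: nat \<Rightarrow> real. \<Sum>x\<in>{0..<n}. \<bar>\<zeta> x - 1 / n\<bar>"
  define X where "X = euler_steps ?E (\<lambda>i. h (Suc i)) j ?F"
  define r where "r = exp (- (real m / 2 * (\<Sum>i<j. h (Suc i))))"
  define P where "P = \<epsilon> / 2 + (\<Sum>x\<in>{0..<n}. \<bar>w x\<bar>)"
  define Q where "Q = (\<lambda>v. real n / (2 * \<epsilon>) * (\<Sum>x\<in>{0..<n}. (v x :: real)\<^sup>2))"
  define d where "d = real (m * k)"
  define y where "y = h 0"
  have y: "0 \<le> y" using Suc.prems by (simp add: y_def)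
  have d: "0 \<le> d" "real (card ?E) = d" by (simp_all add: d_def card_complete_bipartite_edges)
  have P0: "0 \<le> P" using \<epsilon> by (simp add: P_def sum_nonneg)
  have Q0: "0 \<le> Q v" using \<epsilon> by (simp add: Q_def sum_nonneg)
  have X\<eta>: "X \<eta> \<le> P + r * Q v"
    unfolding X_def r_def P_def Q_def by (rule Suc.IH) (use Suc.prems in auto)
  have Xe: "X (edge_average e \<eta>) \<le> P + r * Q (edge_average e v)" if e: "e \<in> ?E" for e
  proof -
    have e': "e \<in> edges_on {0..<n}" using e complete_bipartite_edges_subset unfolding n_def by blast
    then obtain a b where ab: "e = {a, b}" "a \<in> {0..<n}" "b \<in> {0..<n}" "a \<noteq> b"
      by (auto simp: edges_on_def)
    \<comment> \<open>The constant function \<open>1 / n\<close> is fixed by averaging, so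
      \<open>v\<close> and \<open>w\<close> evolve by the same linear map as
      \<open>\<eta>\<close>.\<close>
    have lin: "edge_average e \<eta> x - 1 / n = edge_average e v x + edge_average e w x" if "x \<in> {0..<n}" for x
      using Suc.prems(2)[of x] Suc.prems(2)[of a] Suc.prems(2)[of b] that ab
      by (auto simp: edge_average_def field_simps)
    have "X (edge_average e \<eta>) \<le> \<epsilon> / 2 + (\<Sum>x\<in>{0..<n}. \<bar>edge_average e w x\<bar>) + r * Q (edge_average e v)"
      unfolding X_def r_def Q_def
      by (rule Suc.IH) (use Suc.prems lin sum_edge_average[OF _ e'] in auto)
    also have "\<dots> \<le> P + r * Q (edge_average e v)"
      unfolding P_def using sum_abs_edge_average_le[OF _ e', of w] by simp
    finally show ?thesis .
  qed
  have "(\<Sum>e\<in>?E. Q (edge_average e v)) \<le> (d - real m / 2) * Q v"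
  proof -
    have "(\<Sum>e\<in>?E. Q (edge_average e v)) =
        real n / (2 * \<epsilon>) * (\<Sum>e\<in>?E. \<Sum>x\<in>{0..<n}. (edge_average e v x)\<^sup>2)"
      by (simp add: Q_def sum_distrib_left)
    also have "\<dots> \<le> real n / (2 * \<epsilon>) * ((d - real m / 2) * (\<Sum>x\<in>{0..<n}. (v x)\<^sup>2))"
      unfolding n_def d_def using \<epsilon> Suc.prems(3)
      by (intro mult_left_mono bipartite_spectral_gap m) (auto simp: n_def)
    finally show ?thesis by (simp add: Q_def mult_ac)
  qed
  then have "r * (\<Sum>e\<in>?E. Q (edge_average e v)) \<le> r * ((d - real m / 2) * Q v)"
    by (intro mult_left_mono) (auto simp: r_def)
  moreover have "(\<Sum>e\<in>?E. X (edge_average e \<eta>)) \<le> (\<Sum>e\<in>?E. P + r * Q (edge_average e v))"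
    by (intro sum_mono Xe)
  moreover have "(\<Sum>e\<in>?E. P + r * Q (edge_average e v)) = d * P + r * (\<Sum>e\<in>?E. Q (edge_average e v))"
    using d by (simp add: sum.distrib sum_distrib_left)
  ultimately have sumX: "(\<Sum>e\<in>?E. X (edge_average e \<eta>)) \<le> d * P + r * ((d - real m / 2) * Q v)"
    by linarith
  have "euler_steps ?E h (Suc j) ?F \<eta> = exp (- (d * y)) * (X \<eta> + y * (\<Sum>e\<in>?E. X (edge_average e \<eta>)))"
    unfolding euler_steps_Suc_shift euler_step_def X_def y_def d(2) ..
  also have "\<dots> \<le> exp (- (d * y)) * ((P + r * Q v) + y * (d * P + r * ((d - real m / 2) * Q v)))"
    using sumX X\<eta> y by (intro mult_left_mono add_mono) auto
  also have "\<dots> = exp (- (d * y)) * (1 + d * y) * P + exp (- (d * y)) * (1 + y * (d - real m / 2)) * (r * Q v)"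
    by (simp add: algebra_simps)
  also have "\<dots> \<le> 1 * P + exp (- (real m / 2 * y)) * (r * Q v)"
  proof (intro add_mono mult_right_mono P0)
    show "exp (- (d * y)) * (1 + d * y) \<le> 1" using d y by (intro exp_minus_mult_one_plus) simp
    have "exp (- (d * y)) * (1 + y * (d - real m / 2)) \<le> exp (- (d * y)) * exp (y * (d - real m / 2))"
      by (intro mult_left_mono exp_ge_add_one_self) auto
    also have "\<dots> = exp (- (real m / 2 * y))" by (simp add: exp_add[symmetric] algebra_simps)
    finally show "exp (- (d * y)) * (1 + y * (d - real m / 2)) \<le> exp (- (real m / 2 * y))" .
    show "0 \<le> r * Q v" using Q0 by (simp add: r_def)
  qed
  also have "exp (- (real m / 2 * y)) * (r * Q v) = exp (- (real m / 2 * (\<Sum>i<Suc j. h i))) * Q v"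
    unfolding sum.lessThan_Suc_shift r_def y_def
    by (simp add: exp_add[symmetric] algebra_simps)
  finally show ?case by (simp add: P_def Q_def)
qed

text \<open>What matters is the factor \<open>\<theta>\<close> in the error. It comes from
  \<open>(1 + r) powr \<theta> \<le> 1 + \<theta> * r\<close> and from
  \<open>r powr (1 + \<theta>) \<ge> r - 2 * \<theta> * sqrt r\<close>, where the square root
  absorbs the logarithm through \<open>ln r \<ge> - 2 / sqrt r\<close>.\<close>

lemma one_plus_powr_le:
  fixes r \<theta> :: real
  assumes r: "0 < r" "r \<le> 1" and \<theta>: "0 \<le> \<theta>" "\<theta> \<le> 1"
  shows "(1 + r) powr (1 + \<theta>) \<le> 1 + r powr (1 + \<theta>) + 4 * \<theta> * r powr (1 / 2)"
proof -
  define s where "s = sqrt r"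
  have s: "0 < s" "s \<le> 1" "r = s * s" using r by (auto simp: s_def)
  have rs: "r powr (1 / 2) = s" using r by (simp add: s_def powr_half_sqrt)
  have "(1 + r) powr \<theta> * 1 powr (1 - \<theta>) \<le> \<theta> * (1 + r) + (1 - \<theta>) * 1"
    using r \<theta> by (intro Youngs_inequality_0) auto
  then have "(1 + r) powr \<theta> \<le> 1 + \<theta> * r" by (simp add: algebra_simps)
  then have "(1 + r) * (1 + r) powr \<theta> \<le> (1 + r) * (1 + \<theta> * r)" using r by (intro mult_left_mono) auto
  then have up: "(1 + r) powr (1 + \<theta>) \<le> (1 + r) * (1 + \<theta> * r)" using r by (simp add: powr_add)
  have "ln (1 / s) \<le> 1 / s - 1" using s by (intro ln_le_minus_one) auto
  then have "- (2 / s) \<le> ln r" using s by (simp add: ln_div ln_mult)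
  then have "\<theta> * (- (2 / s)) \<le> \<theta> * ln r" using \<theta> by (intro mult_left_mono)
  moreover have "1 + \<theta> * ln r \<le> r powr \<theta>"
    using exp_ge_add_one_self[of "\<theta> * ln r"] r by (simp add: powr_def)
  ultimately have "1 - 2 * \<theta> / s \<le> r powr \<theta>" by (simp add: mult.commute)
  then have "r * (1 - 2 * \<theta> / s) \<le> r * r powr \<theta>" using r by (intro mult_left_mono) auto
  also have "r * r powr \<theta> = r powr (1 + \<theta>)" using r by (simp add: powr_add)
  also have "r * (1 - 2 * \<theta> / s) = r - 2 * \<theta> * s" using s by (simp add: field_simps)
  finally have low: "r - 2 * \<theta> * s \<le> r powr (1 + \<theta>)" .
  have "r \<le> s" using s mult_left_le[of s s] by simp
  moreover have "r * r \<le> s" using r mult_left_le[of r r] \<open>r \<le> s\<close> by linarith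
  ultimately have "\<theta> * (r + r * r) \<le> \<theta> * (s + s)" using \<theta> by (intro mult_left_mono) auto
  then show ?thesis using up low unfolding rs by (simp add: algebra_simps)
qed

text \<open>By homogeneity the claim reduces to the ratio of the smaller to the larger number; the
  error lists both orders to be symmetric.\<close>

lemma powr_one_plus_add_le:
  fixes a b \<theta> :: real
  assumes "0 \<le> a" "0 \<le> b" and \<theta>: "0 \<le> \<theta>" "\<theta> \<le> 1"
  shows "(a + b) powr (1 + \<theta>) \<le> a powr (1 + \<theta>) + b powr (1 + \<theta>)
    + 4 * \<theta> * (a powr (1 / 2 + \<theta>) * b powr (1 / 2) + b powr (1 / 2 + \<theta>) * a powr (1 / 2))"
proof -
  have *: "(a + b) powr (1 + \<theta>) \<le> a powr (1 + \<theta>) + b powr (1 + \<theta>)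
      + 4 * \<theta> * (a powr (1 / 2 + \<theta>) * b powr (1 / 2))" if "0 < b" "b \<le> a" for a b :: real
  proof -
    define r where "r = b / a"
    have r: "0 < r" "r \<le> 1" "0 < a" "b = a * r" using that by (auto simp: r_def)
    have "(a + b) powr (1 + \<theta>) = a powr (1 + \<theta>) * (1 + r) powr (1 + \<theta>)"
      using r by (simp add: powr_mult[symmetric] algebra_simps)
    also have "\<dots> \<le> a powr (1 + \<theta>) * (1 + r powr (1 + \<theta>) + 4 * \<theta> * r powr (1 / 2))"
      using r \<theta> by (intro mult_left_mono one_plus_powr_le) auto
    also have "\<dots> = a powr (1 + \<theta>) + b powr (1 + \<theta>) + 4 * \<theta> * (a powr (1 + \<theta>) * r powr (1 / 2))"
      using r by (simp add: powr_mult algebra_simps)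
    also have "a powr (1 + \<theta>) * r powr (1 / 2) = a powr (1 / 2 + \<theta>) * b powr (1 / 2)"
      using r by (simp add: powr_mult mult.assoc[symmetric] powr_add[symmetric])
    finally show ?thesis .
  qed
  have nn: "0 \<le> 4 * \<theta> * (x powr (1 / 2 + \<theta>) * y powr (1 / 2))" for x y :: real using \<theta> by simp
  consider "a = 0 \<or> b = 0" | "0 < b" "b \<le> a" | "0 < a" "a \<le> b" using assms by linarith
  then show ?thesis
  proof cases
    case 2 then show ?thesis using *[of b a] nn[of b a] unfolding distrib_left by linarith
  next
    case 3 then show ?thesis using *[of a b] nn[of a b] unfolding distrib_left add.commute[of b a] by linarith
  qed auto
qed

text \<open>This is \<open>x powr s \<le> 1 + x\<close> at \<open>x = c * u\<close>. It trades a
  fractional power for a linear expression, whose sum over the vertices is controlled by the total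
  mass.\<close>

lemma powr_le_scaled:
  fixes u c s :: real
  assumes "0 \<le> u" "0 < c" "0 < s" "s \<le> 1"
  shows "u powr s \<le> c powr (- s) * (1 + c * u)"
proof -
  have "(c * u) powr s \<le> (1 + c * u) powr s" using assms by (intro powr_mono2) auto
  also have "\<dots> \<le> (1 + c * u) powr 1" using assms by (intro powr_mono) auto
  finally have "c powr (- s) * (c powr s * u powr s) \<le> c powr (- s) * (1 + c * u)"
    using assms by (intro mult_left_mono) (auto simp: powr_mult)
  then show ?thesis using assms by (simp add: powr_minus field_simps)
qed

text \<open>Both cross terms are bounded by the same product, which gives
  \<open>8 * \<theta>\<close>, and the factor \<open>2 powr (- (1 + \<theta>)) \<le> 1 / 2\<close>
  leaves \<open>4 * \<theta>\<close>. In use \<open>c\<close> is the number of vertices, so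
  \<open>c * a\<close> is mass relative to equilibrium.\<close>

lemma powr_one_plus_merge:
  fixes a b c \<theta> :: real
  assumes ab: "0 \<le> a" "0 \<le> b" and c: "0 < c" and \<theta>: "0 \<le> \<theta>" "\<theta> \<le> 1 / 2"
  shows "((a + b) / 2) powr (1 + \<theta>) \<le> 2 powr (- (1 + \<theta>)) * (a powr (1 + \<theta>) + b powr (1 + \<theta>))
    + 4 * \<theta> * c powr (- (1 + \<theta>)) * ((1 + c * a) * (1 + c * b))"
proof -
  have cross: "x powr (1 / 2 + \<theta>) * y powr (1 / 2) \<le> c powr (- (1 + \<theta>)) * ((1 + c * x) * (1 + c * y))"
    if "0 \<le> x" "0 \<le> y" for x y
  proof -
    have "x powr (1 / 2 + \<theta>) * y powr (1 / 2) \<le>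
        (c powr (- (1 / 2 + \<theta>)) * (1 + c * x)) * (c powr (- (1 / 2)) * (1 + c * y))"
      using that c \<theta> by (intro mult_mono powr_le_scaled) auto
    also have "\<dots> = (c powr (- (1 / 2 + \<theta>)) * c powr (- (1 / 2))) * ((1 + c * x) * (1 + c * y))"
      by (simp add: mult_ac)
    also have "c powr (- (1 / 2 + \<theta>)) * c powr (- (1 / 2)) = c powr (- (1 + \<theta>))"
      by (simp add: powr_add[symmetric])
    finally show ?thesis .
  qed
  let ?W = "c powr (- (1 + \<theta>)) * ((1 + c * a) * (1 + c * b))"
  have W0: "0 \<le> ?W" using ab c by simp
  have "(a + b) powr (1 + \<theta>) \<le> a powr (1 + \<theta>) + b powr (1 + \<theta>)
      + 4 * \<theta> * (a powr (1 / 2 + \<theta>) * b powr (1 / 2) + b powr (1 / 2 + \<theta>) * a powr (1 / 2))"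
    using ab \<theta> by (intro powr_one_plus_add_le) auto
  also have "\<dots> \<le> a powr (1 + \<theta>) + b powr (1 + \<theta>) + 4 * \<theta> * (?W + ?W)"
    using cross[OF ab] cross[OF ab(2,1)] \<theta>
    by (intro add_left_mono mult_left_mono add_mono) (auto simp: mult.commute)
  also have "4 * \<theta> * (?W + ?W) = 8 * \<theta> * ?W" by simp
  finally have "2 powr (- (1 + \<theta>)) * (a + b) powr (1 + \<theta>) \<le>
      2 powr (- (1 + \<theta>)) * (a powr (1 + \<theta>) + b powr (1 + \<theta>) + 8 * \<theta> * ?W)"
    by (intro mult_left_mono) auto
  also have "2 powr (- (1 + \<theta>)) * (a + b) powr (1 + \<theta>) = ((a + b) / 2) powr (1 + \<theta>)"
    unfolding powr_minus_divide[of 2 "1 + \<theta>"] using ab by (simp add: powr_divide)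
  also have "2 powr (- (1 + \<theta>)) * (a powr (1 + \<theta>) + b powr (1 + \<theta>) + 8 * \<theta> * ?W) =
      2 powr (- (1 + \<theta>)) * (a powr (1 + \<theta>) + b powr (1 + \<theta>)) + 2 powr (- (1 + \<theta>)) * (8 * \<theta> * ?W)"
    by (rule distrib_left)
  also have "2 powr (- (1 + \<theta>)) * (8 * \<theta> * ?W) \<le> 1 / 2 * (8 * \<theta> * ?W)"
  proof (intro mult_right_mono)
    have "2 powr (- (1 + \<theta>)) \<le> 2 powr (- 1 :: real)" using \<theta> by (intro powr_mono) auto
    then show "2 powr (- (1 + \<theta>)) \<le> 1 / 2" by (simp add: powr_minus_divide)
    show "0 \<le> 8 * \<theta> * ?W" using W0 \<theta> by simp
  qed
  finally show ?thesis by (simp add: mult_ac)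
qed

text \<open>The configuration is cut at height \<open>c\<close>. The lower part has sum of squares
  at most \<open>c\<close>, as its entries are at most \<open>c\<close> and the mass is 1. The
  excess is bounded by the power sum, since \<open>c < u\<close> gives
  \<open>1 \<le> (u / c) powr \<theta>\<close>. Recentring both parts yields the mean-zero
  \<open>v\<close> required for the splitting and doubles the bound for the excess.\<close>

lemma euler_steps_L1_truncated:
  fixes m k :: nat
  defines "n \<equiv> m + k"
  assumes m: "1 \<le> m" "m \<le> k" and h: "\<And>i. 0 \<le> h i" and \<epsilon>: "0 < \<epsilon>"
    and \<zeta>: "\<zeta> \<in> prob_mass_functions {0..<n}" and c: "0 < c" and \<theta>: "0 \<le> \<theta>"
  shows "euler_steps (complete_bipartite_edges m k) h j (\<lambda>\<zeta>. \<Sum>x\<in>{0..<n}. \<bar>\<zeta> x - 1 / n\<bar>) \<zeta> \<le>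
    \<epsilon> / 2 + 2 * (c powr (- \<theta>) * (\<Sum>x\<in>{0..<n}. \<zeta> x powr (1 + \<theta>))) +
    exp (- (real m / 2 * (\<Sum>i<j. h i))) * (real n / (2 * \<epsilon>) * c)"
proof -
  have n: "0 < n" using m by (simp add: n_def)
  have \<zeta>0: "0 \<le> \<zeta> x" for x using \<zeta> by (simp add: prob_mass_functions_def)
  have \<zeta>1: "(\<Sum>x\<in>{0..<n}. \<zeta> x) = 1" using \<zeta> by (simp add: prob_mass_functions_def)
  define u where "u = (\<lambda>x. min (\<zeta> x) c)"
  define U where "U = (\<Sum>x\<in>{0..<n}. u x)"
  define v where "v = (\<lambda>x. u x - U / n)"
  define w where "w = (\<lambda>x. (\<zeta> x - u x) - (1 - U) / n)"
  have u: "0 \<le> u x" "u x \<le> \<zeta> x" "u x \<le> c" for x using \<zeta>0 c by (auto simp: u_def)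
  have v0: "(\<Sum>x\<in>{0..<n}. v x) = 0" using n by (simp add: v_def sum_subtractf U_def)
  have excess: "(\<Sum>x\<in>{0..<n}. \<zeta> x - u x) = 1 - U" by (simp add: sum_subtractf \<zeta>1 U_def)
  have U1: "0 \<le> 1 - U" unfolding excess[symmetric] using u by (intro sum_nonneg) auto
  have "(\<Sum>x\<in>{0..<n}. \<bar>w x\<bar>) \<le> (\<Sum>x\<in>{0..<n}. (\<zeta> x - u x) + (1 - U) / n)"
  proof (rule sum_mono)
    fix x
    have "0 \<le> (1 - U) / n" using U1 by simp
    then show "\<bar>w x\<bar> \<le> (\<zeta> x - u x) + (1 - U) / n"
      using u(2)[of x] unfolding w_def by linarith
  qed
  also have "\<dots> = 2 * (1 - U)" using n unfolding sum.distrib excess by simp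
  also have "1 - U \<le> c powr (- \<theta>) * (\<Sum>x\<in>{0..<n}. \<zeta> x powr (1 + \<theta>))"
    unfolding excess[symmetric] sum_distrib_left
  proof (rule sum_mono)
    fix x
    show "\<zeta> x - u x \<le> c powr (- \<theta>) * \<zeta> x powr (1 + \<theta>)"
    proof (cases "\<zeta> x \<le> c")
      case False
      have "c powr (- \<theta>) * c powr \<theta> \<le> c powr (- \<theta>) * \<zeta> x powr \<theta>"
        using False c \<theta> by (intro mult_left_mono powr_mono2) auto
      then have "1 \<le> c powr (- \<theta>) * \<zeta> x powr \<theta>" using c by (simp add: powr_add[symmetric])
      then have "\<zeta> x * 1 \<le> \<zeta> x * (c powr (- \<theta>) * \<zeta> x powr \<theta>)" using \<zeta>0 by (intro mult_left_mono)
      also have "\<zeta> x * (c powr (- \<theta>) * \<zeta> x powr \<theta>) = c powr (- \<theta>) * \<zeta> x powr (1 + \<theta>)"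
        using False c by (simp add: powr_add)
      finally show ?thesis using u(1)[of x] by simp
    qed (simp add: u_def)
  qed
  finally have W: "(\<Sum>x\<in>{0..<n}. \<bar>w x\<bar>) \<le> 2 * (c powr (- \<theta>) * (\<Sum>x\<in>{0..<n}. \<zeta> x powr (1 + \<theta>)))"
    by simp
  have "(\<Sum>x\<in>{0..<n}. (v x)\<^sup>2) = (\<Sum>x\<in>{0..<n}. (u x)\<^sup>2 - 2 * (U / n) * u x + (U / n)\<^sup>2)"
    by (intro sum.cong) (auto simp: v_def power2_diff)
  also have "\<dots> = (\<Sum>x\<in>{0..<n}. (u x)\<^sup>2) - 2 * (U / n) * U + n * (U / n)\<^sup>2"
    by (simp only: sum.distrib sum_subtractf sum_distrib_left[symmetric] U_def[symmetric] sum_constant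
        card_atLeastLessThan diff_zero)
  also have "\<dots> = (\<Sum>x\<in>{0..<n}. (u x)\<^sup>2) - U\<^sup>2 / n"
    using n by (simp add: power2_eq_square field_simps)
  also have "\<dots> \<le> (\<Sum>x\<in>{0..<n}. (u x)\<^sup>2)" by simp
  also have "\<dots> \<le> (\<Sum>x\<in>{0..<n}. c * \<zeta> x)"
    using u c unfolding power2_eq_square by (intro sum_mono mult_mono) auto
  also have "\<dots> = c" by (simp add: sum_distrib_left[symmetric] \<zeta>1)
  finally have Q: "(\<Sum>x\<in>{0..<n}. (v x)\<^sup>2) \<le> c" .
  have "euler_steps (complete_bipartite_edges m k) h j (\<lambda>\<zeta>. \<Sum>x\<in>{0..<n}. \<bar>\<zeta> x - 1 / n\<bar>) \<zeta> \<le>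
    \<epsilon> / 2 + (\<Sum>x\<in>{0..<n}. \<bar>w x\<bar>) +
    exp (- (real m / 2 * (\<Sum>i<j. h i))) * (real n / (2 * \<epsilon>) * (\<Sum>x\<in>{0..<n}. (v x)\<^sup>2))"
  proof (rule euler_steps_L1_split[OF m h \<epsilon>, folded n_def])
    show "\<zeta> x - 1 / n = v x + w x" for x using n by (simp add: v_def w_def field_simps)
  qed (rule v0)
  also have "\<dots> \<le> \<epsilon> / 2 + 2 * (c powr (- \<theta>) * (\<Sum>x\<in>{0..<n}. \<zeta> x powr (1 + \<theta>))) +
    exp (- (real m / 2 * (\<Sum>i<j. h i))) * (real n / (2 * \<epsilon>) * c)"
    using W Q \<epsilon> by (intro add_mono mult_left_mono) auto
  finally show ?thesis .
qed

lemma two_powr_minus_bounds: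
  fixes x :: real assumes "0 \<le> x"
  shows "1 - x * ln 2 \<le> 2 powr (- x)" "2 powr (- x) \<le> 1 - x * ln 2 + x\<^sup>2"
proof -
  define y where "y = x * ln 2"
  have y: "0 \<le> y" "y \<le> x" using assms ln_2_less_1 by (auto simp: y_def mult_left_le)
  have e: "2 powr (- x) = exp (- y)" by (simp add: powr_def y_def)
  show "1 - x * ln 2 \<le> 2 powr (- x)" using exp_ge_add_one_self[of "- y"] by (simp add: e y_def)
  have "exp (- y) * (1 + y) \<le> 1" by (rule exp_minus_mult_one_plus(1)[OF y(1)])
  \<comment> \<open>The product equals \<open>1 + y ^ 3\<close>.\<close>
  also have "1 \<le> (1 - y + y\<^sup>2) * (1 + y)" using y by (simp add: power2_eq_square algebra_simps)
  finally have "exp (- y) \<le> 1 - y + y\<^sup>2" using y by simp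
  also have "y\<^sup>2 \<le> x\<^sup>2" using y by (intro power_mono) auto
  finally show "2 powr (- x) \<le> 1 - x * ln 2 + x\<^sup>2" by (simp add: e y_def)
qed

text \<open>Three errors end as multiples of \<open>exp (- (a / 4))\<close>:
  \<open>12 * exp 24\<close> from the decay of the initial potential, 480 from the level at which
  merging sustains it, and 1 from the spectral stage.\<close>

lemma averaging_process_L1_upper:
  fixes m k :: nat
  defines "n \<equiv> m + k" and "L \<equiv> ln (real (m + k))"
  assumes m: "1 \<le> m" "m \<le> k" and L: "10000 \<le> L"
    and proc: "averaging_process {0..<n} (complete_bipartite_edges m k) \<xi> M \<eta>"
    and \<xi>: "\<xi> \<in> prob_mass_functions {0..<n}"
    and a: "0 < a" and T: "T = cutoff_time n m a"
  shows "(\<integral>\<omega>. (\<Sum>x\<in>{0..<n}. \<bar>\<eta> T \<omega> x - 1 / n\<bar>) \<partial>M) \<le> (12 * exp 24 + 481) * exp (- (a / 4))"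
proof -
  let ?E = "complete_bipartite_edges m k"
  define N where "N = real m + real k"
  have N: "real n = N" "0 < N" "real m \<le> N" "real k \<le> N" "N \<le> 2 * real k" and n: "0 < n"
    and k: "1 \<le> k"
    using m by (simp_all add: N_def n_def)
  define \<theta> where "\<theta> = 1 / sqrt L"
  have "sqrt (100\<^sup>2) \<le> sqrt L" using L by (intro real_sqrt_le_mono) simp
  then have sL: "100 \<le> sqrt L" by simp
  then have \<theta>: "0 < \<theta>" "\<theta> \<le> 1 / 100" "\<theta> * sqrt L = 1"
    using L by (auto simp: \<theta>_def divide_simps)
  have \<theta>2L: "\<theta>\<^sup>2 * L = 1" using L by (simp add: \<theta>_def power_divide)
  define p where "p = 1 + \<theta>"
  define \<delta> where "\<delta> = 1 / 2 - 2 powr (- p)"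
  define \<beta> where "\<beta> = 4 * \<theta> * N powr (- p)"
  define \<gamma> where "\<gamma> = 20 * \<beta> * N"
  define \<rho> where "\<rho> = 1 + 4 * \<delta> * (real k - real m) / (real m + real k)"
  \<comment> \<open>The 12 is 10 from \<open>40 * \<delta>\<^sup>2\<close> with
    \<open>\<delta> \<le> \<theta> / 2\<close>, plus 2 from the remainder in
    \<open>two_powr_minus_bounds\<close>.\<close>
  define l where "l = 2 * (\<theta> * ln 2) * (real m * real k / N) - 12 * real m * \<theta>\<^sup>2"
  have \<theta>sq: "0 \<le> \<theta>\<^sup>2" "\<theta>\<^sup>2 \<le> \<theta> / 100"
    using \<theta> mult_left_mono[of \<theta> "1/100" \<theta>] by (auto simp: power2_eq_square)
  have \<delta>': "2 * \<delta> = 1 - 2 powr (- \<theta>)" by (simp add: \<delta>_def p_def powr_diff powr_minus_divide)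
  have \<delta>0: "\<theta> * ln 2 - \<theta>\<^sup>2 \<le> 2 * \<delta>" "2 * \<delta> \<le> \<theta> * ln 2"
    using two_powr_minus_bounds[of \<theta>] \<theta> unfolding \<delta>' by auto
  have ln2: "\<theta> * ln 2 \<le> \<theta>" "2 / 3 * \<theta> \<le> \<theta> * ln 2"
    using \<theta> ln_2_less_1 ln2_ge_two_thirds by (auto simp: mult_left_le mult.commute)
  have \<delta>1: "0 \<le> \<delta>" "\<delta> \<le> \<theta> / 2" using \<delta>0 ln2 \<theta>sq \<theta> by linarith+
  have \<delta>8: "\<bar>\<delta>\<bar> \<le> 1 / 8" using \<delta>1 \<theta> by simp
  have q: "0 \<le> real m * real k / N" "real m * real k / N \<le> real m" "real m / 2 \<le> real m * real k / N"
    using N mult_left_mono[OF N(5), of "real m"] mult_left_mono[OF N(4), of "real m"] by (auto simp: divide_simps mult_left_mono mult_ac)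
  have "\<delta>\<^sup>2 \<le> (\<theta> / 2)\<^sup>2" using \<delta>1 by (intro power_mono) auto
  then have d2: "40 * real m * \<delta>\<^sup>2 \<le> 10 * real m * \<theta>\<^sup>2"
    using mult_left_mono[of "\<delta>\<^sup>2" "\<theta>\<^sup>2 / 4" "40 * real m"] by (simp add: power_divide)
  have l1: "l \<le> 4 * \<delta> * real m * real k / (real m + real k) - 40 * real m * \<delta>\<^sup>2"
  proof -
    have "(2 * (\<theta> * ln 2 - \<theta>\<^sup>2)) * (real m * real k / N) \<le> 4 * \<delta> * (real m * real k / N)"
      using \<delta>0 q(1) by (intro mult_right_mono) auto
    moreover have "2 * \<theta>\<^sup>2 * (real m * real k / N) \<le> 2 * \<theta>\<^sup>2 * real m"
      using q(2) by (intro mult_left_mono) auto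
    ultimately show ?thesis using d2 unfolding l_def N_def[symmetric] by (simp add: algebra_simps)
  qed
  \<comment> \<open>The merging source is proportional to \<open>\<theta> * m\<close>, so the decay
    rate must be at least of that order. The constants fit because
    \<open>2 / 3 - 12 / 100 > 1 / 2\<close>.\<close>
  have l_low: "\<theta> * real m / 2 \<le> l"
  proof -
    have "2 * (2 / 3 * \<theta>) * (real m / 2) \<le> 2 * (\<theta> * ln 2) * (real m * real k / N)"
      by (rule mult_mono) (use ln2 \<theta> q in auto)
    moreover have "12 * real m * \<theta>\<^sup>2 \<le> 12 * real m * (\<theta> / 100)" using \<theta>sq by (intro mult_left_mono) auto
    moreover have "0 \<le> \<theta> * real m" using \<theta> by simp
    ultimately show ?thesis unfolding l_def by (simp add: algebra_simps)
  qed
  have l_up: "l \<le> real m / 50"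
  proof -
    have "2 * (\<theta> * ln 2) \<le> 2 * (1 / 100)" using ln2 \<theta>(2) by linarith
    then have "2 * (\<theta> * ln 2) * (real m * real k / N) \<le> 2 * (1 / 100) * real m"
      by (rule mult_mono[OF _ q(2) _ q(1)]) simp
    moreover have "0 \<le> 12 * real m * \<theta>\<^sup>2" by simp
    ultimately show ?thesis unfolding l_def by linarith
  qed
  have l0: "0 < l" using l_low \<theta> m mult_pos_pos[of \<theta> "real m"] by linarith
  have l4: "4 * l \<le> N" using l_up N by linarith
  have w: "1 / 2 \<le> \<rho>" "\<rho> \<le> 3 / 2"
    using bipartite_weights(1,2)[of "real m" "real k" \<delta> \<rho> l] m \<delta>8 l1 by (auto simp: \<rho>_def)
  have Np: "N powr (- p) * N = N powr (- \<theta>)"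
    using N by (simp add: p_def powr_diff powr_minus field_simps)
  have \<gamma>': "\<gamma> = 80 * \<theta> * N powr (- \<theta>)" unfolding \<gamma>_def \<beta>_def Np[symmetric] by simp
  have N1: "N powr (- \<theta>) \<le> 1"
  proof -
    have "1 \<le> N powr \<theta>" using N \<theta> m by (intro ge_one_powr_ge_zero) (auto simp: N_def)
    then show ?thesis by (simp add: powr_minus_divide divide_simps)
  qed
  have \<gamma>1: "0 \<le> \<gamma>" "\<gamma> \<le> 4 / 5"
  proof -
    show "0 \<le> \<gamma>" using \<theta> by (simp add: \<gamma>')
    have "80 * \<theta> * N powr (- \<theta>) \<le> 80 * (1 / 100) * 1" using \<theta> N1 by (intro mult_mono) auto
    then show "\<gamma> \<le> 4 / 5" by (simp add: \<gamma>')
  qed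
  define H where "H = power_potential m k p \<rho> \<gamma>"
  have H0: "0 \<le> H \<zeta>" if "\<zeta> \<in> prob_mass_functions {0..<n}" for \<zeta>
    unfolding H_def power_potential_def
    using w \<gamma>1 that by (intro sum_nonneg) (auto simp: prob_mass_functions_def)
  \<comment> \<open>The level at which the source
    \<open>60 * \<theta> * m * N powr (- \<theta>)\<close> is balanced by decay at rate
    \<open>\<theta> * m / 2\<close>.\<close>
  define c where "c = 120 * N powr (- \<theta>)"
  have drift: "(\<Sum>e\<in>?E. H (edge_average e \<zeta>) - H \<zeta>) \<le> l * (c - H \<zeta>)"
    if "\<zeta> \<in> prob_mass_functions {0..<n}" for \<zeta>
  proof -
    have "(\<Sum>e\<in>?E. H (edge_average e \<zeta>) - H \<zeta>) \<le> 15 * \<beta> * (real m + real k) * real m - l * H \<zeta>"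
      unfolding H_def
    proof (rule power_potential_drift[where \<beta> = \<beta> and \<delta> = \<delta> and p = p, OF m \<delta>8 _ l1])
      fix a b :: real assume "0 \<le> a" "0 \<le> b"
      then show "((a + b) / 2) powr p \<le> (1 / 2 - \<delta>) * (a powr p + b powr p)
          + \<beta> * ((1 + (real m + real k) * a) * (1 + (real m + real k) * b))"
        using powr_one_plus_merge[of a b N \<theta>] N \<theta> by (simp add: \<delta>_def \<beta>_def p_def N_def)
    qed (use that l4 \<theta> in \<open>auto simp: \<rho>_def n_def N_def \<gamma>_def \<beta>_def\<close>)
    also have "15 * \<beta> * (real m + real k) * real m = 60 * \<theta> * (N powr (- p) * N) * real m"
      by (simp add: \<beta>_def N_def)
    also have "\<dots> = (\<theta> * real m / 2) * c" unfolding Np c_def by simp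
    also have "\<dots> \<le> l * c" using l_low by (intro mult_right_mono) (auto simp: c_def)
    finally show ?thesis by (simp add: algebra_simps)
  qed
  have EV: "finite {0..<n}" "finite ?E" "?E \<subseteq> edges_on {0..<n}"
    using finite_complete_bipartite_edges complete_bipartite_edges_subset by (auto simp: n_def)
  have card_E: "card ?E = m * k" by (rule card_complete_bipartite_edges)
  then have Ene: "?E \<noteq> {}" using m k by auto
  have lE: "l \<le> real (card ?E)"
  proof -
    have "real m * 1 \<le> real m * real k" using k by (intro mult_left_mono) auto
    then show ?thesis using l_up unfolding card_E of_nat_mult by linarith
  qed
  define F where "F = (\<lambda>\<zeta> :: nat \<Rightarrow> real. \<Sum>x\<in>{0..<n}. \<bar>\<zeta> x - 1 / n\<bar>)"
  have F0: "0 \<le> F \<zeta>" for \<zeta> unfolding F_def by (simp add: sum_nonneg)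
  have F2: "F \<zeta> \<le> 2" if "\<zeta> \<in> prob_mass_functions {0..<n}" for \<zeta>
    unfolding F_def by (rule sum_abs_diff_le_2[OF that n])
  define t where "t = N / (2 * real k) * (L / (ln 2 * real m))"
  define s where "s = a * (sqrt L / real m)"
  have T_eq: "T = t + s"
    unfolding T n_def t_def s_def using cutoff_time_eq[of m k a] m by (simp add: N_def L_def)
  have ts: "0 < t" "0 < s" using N m k L sL a by (simp_all add: t_def s_def)
  \<comment> \<open>The cut height relative to equilibrium:
    \<open>K powr (- \<theta>) = exp (- (a / 4))\<close> makes the tall mass small, while
    \<open>K\<close> is still beaten by the spectral factor
    \<open>exp (- (a * sqrt L / 2))\<close>.\<close>
  define K where "K = exp (a * sqrt L / 4)"
  define \<epsilon> where "\<epsilon> = exp (- (a / 4))"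
  define C0 where "C0 = \<epsilon> / 2 + exp (- (real m / 2 * s)) * (real n / (2 * \<epsilon>) * (K / N))"
  define C1 where "C1 = 4 * (K / N) powr (- \<theta>)"
  have KN: "0 < K / N" using N by (simp add: K_def)
  have "(\<integral>\<omega>. F (\<eta> (t + s) \<omega>) \<partial>M) \<le> C1 * (exp (- (l * t)) * 3 + c) + C0"
  proof (rule averaging_process_expectation_le[OF proc EV(2) Ene EV(3) F0 F2 _ ts])
    show "(\<lambda>\<omega>. F (\<eta> (t + s) \<omega>)) \<in> borel_measurable M"
      using sum_abs_diff_measurable[OF proc, of "t + s"] ts unfolding F_def by simp
    fix h h' :: "nat \<Rightarrow> real" and i j :: nat
    assume h: "\<And>i. 0 \<le> h i" "\<And>i. 0 \<le> h' i" and sums: "sum h {..<i} = t" "sum h' {..<j} = s"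
    have stage2: "euler_steps ?E h' j F \<zeta> \<le> C1 * H \<zeta> + C0" if z: "\<zeta> \<in> prob_mass_functions {0..<n}" for \<zeta>
    proof -
      have "\<zeta> x powr (1 + \<theta>) \<le> 2 * (if x < m then \<zeta> x powr p + \<gamma> * \<zeta> x else \<rho> * \<zeta> x powr p)" for x
      proof -
        have "0 \<le> \<gamma> * \<zeta> x" using \<gamma>1 z by (simp add: prob_mass_functions_def)
        moreover have "\<zeta> x powr p \<le> 2 * (\<rho> * \<zeta> x powr p)"
          using mult_right_mono[OF w(1), of "\<zeta> x powr p"] by simp
        ultimately show ?thesis by (simp add: p_def[symmetric])
      qed
      then have "(\<Sum>x\<in>{0..<n}. \<zeta> x powr (1 + \<theta>)) \<le> 2 * H \<zeta>"
        unfolding H_def power_potential_def n_def sum_distrib_left by (intro sum_mono)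
      then have "2 * ((K / N) powr (- \<theta>) * (\<Sum>x\<in>{0..<n}. \<zeta> x powr (1 + \<theta>))) \<le>
          2 * ((K / N) powr (- \<theta>) * (2 * H \<zeta>))"
        by (intro mult_left_mono) auto
      moreover have "euler_steps ?E h' j F \<zeta> \<le>
        \<epsilon> / 2 + 2 * ((K / N) powr (- \<theta>) * (\<Sum>x\<in>{0..<n}. \<zeta> x powr (1 + \<theta>))) +
        exp (- (real m / 2 * (\<Sum>i<j. h' i))) * (real n / (2 * \<epsilon>) * (K / N))"
        unfolding F_def n_def
        by (rule euler_steps_L1_truncated[OF m h(2) _ _ KN])
           (use z \<theta> in \<open>auto simp: n_def \<epsilon>_def\<close>)
      ultimately show ?thesis unfolding C0_def C1_def sums(2)[symmetric] by linarith
    qed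
    have C0: "0 \<le> C0" using KN unfolding C0_def \<epsilon>_def
      by (intro add_nonneg_nonneg mult_nonneg_nonneg) auto
    have H3: "H \<xi> \<le> 3"
    proof -
      have x01: "0 \<le> \<xi> x" "\<xi> x \<le> 1" if "x < n" for x
        using \<xi> that member_le_sum[of x "{0..<n}" \<xi>] by (auto simp: prob_mass_functions_def)
      have "H \<xi> \<le> (\<Sum>x\<in>{0..<n}. 3 * \<xi> x)"
        unfolding H_def power_potential_def n_def
      proof (rule sum_mono)
        fix x assume "x \<in> {0..<m + k}"
        then have x: "0 \<le> \<xi> x" "\<xi> x \<le> 1" using x01[of x] by (auto simp: n_def)
        have "\<xi> x powr p \<le> \<xi> x" using powr_mono'[of 1 p "\<xi> x"] x \<theta> by (simp add: p_def)
        moreover have "\<gamma> * \<xi> x \<le> 4 / 5 * \<xi> x" using \<gamma>1 x by (intro mult_right_mono) auto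
        moreover have "\<rho> * \<xi> x powr p \<le> 3 / 2 * \<xi> x powr p" using w by (intro mult_right_mono) auto
        ultimately show "(if x < m then \<xi> x powr p + \<gamma> * \<xi> x else \<rho> * \<xi> x powr p) \<le> 3 * \<xi> x"
          using x by simp
      qed
      also have "\<dots> = 3" using \<xi> by (simp add: sum_distrib_left[symmetric] prob_mass_functions_def)
      finally show ?thesis .
    qed
    have "euler_steps ?E h i (euler_steps ?E h' j F) \<xi> \<le> euler_steps ?E h i (\<lambda>\<zeta>. C1 * H \<zeta> + C0) \<xi>"
      by (rule euler_steps_mono[OF EV(1,3) h(1) \<xi> stage2])
    also have "\<dots> \<le> C1 * euler_steps ?E h i H \<xi> + C0"
      by (rule euler_steps_affine_le[OF EV(2) h(1) C0])
    also have "euler_steps ?E h i H \<xi> \<le> exp (- (l * (\<Sum>i'<i. h i'))) * H \<xi> + c"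
      by (rule euler_steps_drift[OF EV h(1) H0 drift lE _ \<xi>]) (auto simp: c_def)
    also have "exp (- (l * (\<Sum>i'<i. h i'))) * H \<xi> \<le> exp (- (l * t)) * 3"
      unfolding sums using H3 by (intro mult_left_mono) auto
    finally show "euler_steps ?E h i (euler_steps ?E h' j F) \<xi> \<le> C1 * (exp (- (l * t)) * 3 + c) + C0"
      by (simp add: C1_def mult_left_mono)
  qed
  also have "C1 * (exp (- (l * t)) * 3 + c) \<le> \<epsilon> * (12 * exp 24 + 480)"
  proof -
    \<comment> \<open>The time \<open>t\<close> makes the first-order decay exactly
      \<open>\<theta> * L\<close>; the correction costs \<open>12 * 2 = 24\<close>, as
      \<open>t \<le> 2 * L / m\<close>.\<close>
    have "2 * (\<theta> * ln 2) * (real m * real k / N) * t = \<theta> * L"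
      unfolding t_def using N m k by (simp add: field_simps)
    moreover have "12 * real m * \<theta>\<^sup>2 * t \<le> 12 * real m * \<theta>\<^sup>2 * (1 * (L / (1 / 2 * real m)))"
      unfolding t_def using N k m L ln_2_ge_half
      by (intro mult_left_mono mult_mono divide_left_mono mult_right_mono) auto
    moreover have "12 * real m * \<theta>\<^sup>2 * (1 * (L / (1 / 2 * real m))) = 24 * (\<theta>\<^sup>2 * L)"
      using m by (simp add: field_simps)
    ultimately have "\<theta> * L - 24 \<le> l * t" unfolding \<theta>2L l_def by (simp add: left_diff_distrib)
    then have "exp (- (l * t)) \<le> exp (24 - \<theta> * L)" by simp
    also have "\<dots> = exp 24 * N powr (- \<theta>)"
      using N by (simp add: powr_def L_def N_def exp_diff exp_minus field_simps)
    finally have "exp (- (l * t)) * 3 + c \<le> N powr (- \<theta>) * (3 * exp 24 + 120)"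
      by (simp add: c_def algebra_simps)
    then have "C1 * (exp (- (l * t)) * 3 + c) \<le> C1 * (N powr (- \<theta>) * (3 * exp 24 + 120))"
      by (intro mult_left_mono) (auto simp: C1_def)
    also have "\<dots> = \<epsilon> * (12 * exp 24 + 480)"
    proof -
      have K: "K powr (- \<theta>) = \<epsilon>"
        using \<theta>(3) by (simp add: K_def \<epsilon>_def powr_def mult.commute[of \<theta>] mult.assoc)
      have "C1 = 4 * (K powr (- \<theta>) * N powr \<theta>)"
        using N by (simp add: C1_def powr_divide powr_minus_divide K_def)
      then have "C1 = 4 * \<epsilon> * N powr \<theta>" unfolding K by simp
      moreover have "N powr \<theta> * N powr (- \<theta>) = 1" using N by (simp add: powr_add[symmetric])
      moreover have "4 * \<epsilon> * N powr \<theta> * (N powr (- \<theta>) * (3 * exp 24 + 120)) =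
          (N powr \<theta> * N powr (- \<theta>)) * (\<epsilon> * (12 * exp 24 + 480))" by (simp add: algebra_simps)
      ultimately show ?thesis by simp
    qed
    finally show ?thesis .
  qed
  also have "C0 \<le> \<epsilon>"
  proof -
    have ms: "real m / 2 * s = a * sqrt L / 2" using m by (simp add: s_def)
    have "exp (- (real m / 2 * s)) * (real n / (2 * \<epsilon>) * (K / N)) =
        exp (- (a * sqrt L / 2)) * K / \<epsilon> / 2"
      unfolding ms N(1) using N by (simp add: field_simps)
    also have "exp (- (a * sqrt L / 2)) * K / \<epsilon> = exp (- (a * sqrt L / 2) + a * sqrt L / 4 + a / 4)"
      by (simp only: K_def \<epsilon>_def exp_add[symmetric] exp_diff[symmetric] diff_minus_eq_add)
    also have "\<dots> \<le> \<epsilon>"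
    proof -
      \<comment> \<open>\<open>sqrt L \<ge> 2\<close> brings the exponent
        \<open>- a * sqrt L / 4 + a / 4\<close> below \<open>- a / 4\<close>.\<close>
      have "a * 2 \<le> a * sqrt L" using a sL by (intro mult_left_mono) auto
      then show ?thesis by (simp add: \<epsilon>_def)
    qed
    finally show ?thesis unfolding C0_def by linarith
  qed
  finally show ?thesis unfolding F_def T_eq by (simp add: \<epsilon>_def algebra_simps)
qed

section \<open>Passage to the limits in \<open>n\<close> and \<open>a\<close>\<close>

theorem theorem1p2:
  fixes m :: "nat \<Rightarrow> nat"
    and M :: "nat \<Rightarrow> (nat \<Rightarrow> real) \<Rightarrow> 'a measure"
    and \<eta> :: "nat \<Rightarrow> (nat \<Rightarrow> real) \<Rightarrow> real \<Rightarrow> 'a \<Rightarrow> nat \<Rightarrow> real"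
    and D :: "real \<Rightarrow> nat \<Rightarrow> ereal"
  assumes m: "\<And>n. 2 \<le> n \<Longrightarrow> 1 \<le> m n \<and> real (m n) \<le> real n / 2"
    and process: "\<And>n \<xi>. 2 \<le> n \<Longrightarrow> \<xi> \<in> prob_mass_functions {0..<n} \<Longrightarrow>
      averaging_process {0..<n} (complete_bipartite_edges (m n) (n - m n)) \<xi> (M n \<xi>) (\<eta> n \<xi>)"
  defines "D \<equiv> \<lambda>a n. SUP \<xi>\<in>prob_mass_functions {0..<n}.
      ereal (\<integral>\<omega>. L1_norm {0..<n} (uniform_mass {0..<n})
        (\<lambda>x. \<eta> n \<xi> (cutoff_time n (m n) a) \<omega> x / uniform_mass {0..<n} x - 1) \<partial>(M n \<xi>))"
  shows "((\<lambda>a. limsup (D a)) \<longlongrightarrow> 0) at_top \<and> ((\<lambda>a. liminf (D a)) \<longlongrightarrow> 2) at_bot"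
proof -
  define T where "T = (\<lambda>a n. cutoff_time n (m n) a)"
  define I where "I = (\<lambda>a n \<xi>. \<integral>\<omega>. (\<Sum>x\<in>{0..<n}. \<bar>\<eta> n \<xi> (T a n) \<omega> x - 1 / n\<bar>) \<partial>(M n \<xi>))"
  define dirac :: "nat \<Rightarrow> real" where "dirac = (\<lambda>x. if x = 0 then 1 else 0)"
  \<comment> \<open>The processes are given for \<open>2 \<le> n\<close>; limits in \<open>n\<close>
    ignore the remaining indices.\<close>
  have D_eq: "D a n = (SUP \<xi>\<in>prob_mass_functions {0..<n}. ereal (I a n \<xi>))" if "2 \<le> n" for a n
    unfolding D_def I_def T_def using that by (subst L1_norm_uniform) auto
  have I0: "0 \<le> I a n \<xi>" for a n \<xi> unfolding I_def by (simp add: sum_nonneg)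
  have dirac: "dirac \<in> prob_mass_functions {0..<n}" if "2 \<le> n" for n
    using that by (auto simp: dirac_def prob_mass_functions_def)
  have D0: "0 \<le> D a n" if "2 \<le> n" for a n
    unfolding D_eq[OF that] using dirac[OF that] I0 by (intro SUP_upper2[OF dirac[OF that]]) auto
  have parts: "1 \<le> m n" "m n \<le> n - m n" "m n + (n - m n) = n" if "2 \<le> n" for n
    using m[OF that] by auto
  have ln_large: "\<forall>\<^sub>F n in sequentially. c \<le> ln (real n)" for c
    using filterlim_compose[OF ln_at_top filterlim_real_sequentially] by (simp add: filterlim_at_top)
  have large: "\<forall>\<^sub>F n in sequentially. 2 \<le> n" by (rule eventually_ge_at_top)
  \<comment> \<open>The process is specified only at nonnegative times, so negative \<open>a\<close>
    needs care. Up to the factor \<open>1 / m\<close>, the leading term is at least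
    \<open>L / 2\<close>, while \<open>16 * a\<^sup>2 \<le> L\<close> keeps the shift within
    \<open>L / 4\<close>.\<close>
  have T_pos: "\<forall>\<^sub>F n in sequentially. 0 < T a n" for a
    using large ln_large[of "max 1 (16 * a\<^sup>2)"]
  proof eventually_elim
    case (elim n)
    define k where "k = n - m n"
    define L where "L = ln (real n)"
    have mk: "1 \<le> m n" "m n \<le> k" "m n + k = n" using parts[OF elim(1)] by (auto simp: k_def)
    have L: "1 \<le> L" "16 * a\<^sup>2 \<le> L" using elim(2) by (auto simp: L_def)
    have a: "4 * \<bar>a\<bar> \<le> sqrt L" using L(2) by (intro real_le_rsqrt) (simp add: power_mult_distrib)
    have "4 * \<bar>a\<bar> * sqrt L \<le> sqrt L * sqrt L" using a L by (intro mult_right_mono) auto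
    then have "4 * \<bar>a * sqrt L\<bar> \<le> L" using L by (simp add: abs_mult)
    then have "0 < 1 / 2 * (L / 1) + a * sqrt L" using L(1) by linarith
    also have "1 / 2 * (L / 1) \<le> (real (m n) + real k) / (2 * real k) * (L / ln 2)"
      using mk L ln_2_less_1 by (intro mult_mono divide_left_mono) (auto simp: divide_simps)
    finally have "0 < ((real (m n) + real k) / (2 * real k) * (L / ln 2) + a * sqrt L) / real (m n)"
      using mk by simp
    also have "\<dots> = T a n"
      using cutoff_time_eq[of "m n" k a] mk unfolding T_def L_def mk(3)
      by (simp add: add_divide_distrib mult.commute[of "ln 2"])
    finally show ?case .
  qed
  have upper: "limsup (D a) \<le> ereal ((12 * exp 24 + 481) * exp (- (a / 4)))" if a: "0 < a" for a
  proof (rule Limsup_bounded)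
    show "\<forall>\<^sub>F n in sequentially. D a n \<le> ereal ((12 * exp 24 + 481) * exp (- (a / 4)))"
      using large ln_large[of 10000]
    proof eventually_elim
      case (elim n)
      note p = parts[OF elim(1)]
      show ?case
        unfolding D_eq[OF elim(1)] I_def
        by (intro SUP_least, subst ereal_less_eq)
           (use averaging_process_L1_upper[of "m n" "n - m n", unfolded p(3), OF p(1,2) elim(2) process[OF elim(1)] _ a]
             in \<open>auto simp: T_def\<close>)
    qed
  qed
  have lower: "ereal (2 - 4 * exp (84 + a / 2)) \<le> liminf (D a)" if a: "a < 0" for a
  proof (rule Liminf_bounded)
    show "\<forall>\<^sub>F n in sequentially. ereal (2 - 4 * exp (84 + a / 2)) \<le> D a n"
      using large ln_large[of 64] T_pos[of a]
    proof eventually_elim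
      case (elim n)
      note p = parts[OF elim(1)]
      have "2 - 4 * exp (84 - (- a) / 2) \<le> I a n dirac"
        unfolding I_def T_def
        by (rule averaging_process_L1_lower[of "m n" "n - m n", unfolded p(3), OF p(1,2) elim(2)
              process[OF elim(1) dirac[OF elim(1)]] dirac_def])
           (use a elim(3) in \<open>auto simp: T_def\<close>)
      then show ?case
        unfolding D_eq[OF elim(1)] by (intro SUP_upper2[OF dirac[OF elim(1)]]) simp
    qed
  qed
  have le_2: "liminf (D a) \<le> 2" for a
  proof -
    have "\<forall>\<^sub>F n in sequentially. D a n \<le> 2"
      using large T_pos[of a]
    proof eventually_elim
      case (elim n)
      have "I a n \<xi> \<le> 2" if "\<xi> \<in> prob_mass_functions {0..<n}" for \<xi>
        unfolding I_def
        by (rule averaging_process_L1_le_2[OF process[OF elim(1) that]]) (use elim in auto)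
      then show ?case unfolding D_eq[OF elim(1)] by (intro SUP_least) simp
    qed
    then have "limsup (D a) \<le> 2" by (rule Limsup_bounded)
    then show ?thesis using Liminf_le_Limsup[of sequentially "D a"] by auto
  qed
  have ge_0: "0 \<le> limsup (D a)" for a
  proof -
    have "\<forall>\<^sub>F n in sequentially. 0 \<le> D a n" using large by eventually_elim (rule D0)
    then have "0 \<le> liminf (D a)" by (rule Liminf_bounded)
    then show ?thesis using Liminf_le_Limsup[of sequentially "D a"] by auto
  qed
  have "((\<lambda>a. limsup (D a)) \<longlongrightarrow> 0) at_top"
  proof (rule tendsto_sandwich[of "\<lambda>_. 0"])
    show "\<forall>\<^sub>F a in at_top. limsup (D a) \<le> ereal ((12 * exp 24 + 481) * exp (- (a / 4)))"
      using eventually_gt_at_top[of 0] by eventually_elim (rule upper)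
    have "((\<lambda>a :: real. (12 * exp 24 + 481) * exp (- (a / 4))) \<longlongrightarrow> 0) at_top" by real_asymp
    then show "((\<lambda>a. ereal ((12 * exp 24 + 481) * exp (- (a / 4)))) \<longlongrightarrow> 0) at_top"
      by (simp add: zero_ereal_def)
  qed (use ge_0 in auto)
  moreover have "((\<lambda>a. liminf (D a)) \<longlongrightarrow> 2) at_bot"
  proof (rule tendsto_sandwich[of "\<lambda>a. ereal (2 - 4 * exp (84 + a / 2))" _ _ "\<lambda>_. 2"])
    show "\<forall>\<^sub>F a in at_bot. ereal (2 - 4 * exp (84 + a / 2)) \<le> liminf (D a)"
      using eventually_gt_at_bot[of 0] by eventually_elim (rule lower)
    have "((\<lambda>a :: real. 2 - 4 * exp (84 + a / 2)) \<longlongrightarrow> 2) at_bot" by real_asymp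
    then show "((\<lambda>a. ereal (2 - 4 * exp (84 + a / 2))) \<longlongrightarrow> 2) at_bot"
      using tendsto_ereal by fastforce
  qed (use le_2 in auto)
  ultimately show ?thesis by blast
qed

end
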